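(* Suppose that for each $t\in\{1,\dots,T-1\}$ the state space $\mathcal X_t\subset\mathbb R^{d_t}$ is contained in a ball of diameter $D_t>0$. Then for the consecutive dual dynamic programming (CDDP) algorithm with target optimality gap $\varepsilon>0$, the total number $\#\mathrm{Eval}_{\mathrm{CDDP}}$ of subproblem oracle evaluations (initial stage and noninitial stage) before termination is bounded by $$\#\mathrm{Eval}_{\mathrm{CDDP}}\le 1+T\cdot\inf_{\delta}\left\{\sum_{t=1}^{T-1}\left(1+\frac{2M_{t+1}D_t}{\delta_t-\delta_{t+1}}\right)^{d_t}:\ \varepsilon=\delta_1>\delta_2>\cdots>\delta_T=0\right\},$$ where the infimum is over vectors $\delta=(\delta_1,\dots,\delta_T)$.
   Context: **Problem.** Let $T\ge 2$, $\mathcal T=\{1,\dots,T\}$, $\mathcal T'=\{2,\dots,T\}$. For $t\in\mathcal T$, $\mathcal X_t\subset\mathbb R^{d_t}$ is a nonempty compact convex set (state space); $\Xi_t\subseteq\mathbb R^{m_t}$ is a nonempty uncertainty set (a Borel set; convex or finite); $x_0\in\mathbb R^{d_0}$ and $\xi_1$ are fixed deterministic parameters ($\mathcal X_0=\{x_0\}$, $\Xi_1=\{\xi_1\}$). The cost $f_t:\mathbb R^{d_{t-1}}\times\mathbb R^{d_t}\times\Xi_t\to[0,+\infty]$, $(x_{t-1},x_t,\xi_t)\mapsto f_t(x_{t-1},x_t;\xi_t)$, is lower semicontinuous and is convex in $(x_{t-1},x_t)$ for each $\xi_t$. For $t\in\mathcal T'$, $\mathcal P_t$ is a nonempty set of Borel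 probability measures on $\Xi_t$. There is $x_1\in\mathcal X_1$ with $f_1(x_0,x_1;\xi_1)<+\infty$. $\|\cdot\|$ is a norm on each $\mathbb R^{d_t}$ (balls are with respect to this norm), and $\|\cdot\|_*$ is its dual norm. **Regularized cost-to-go functions.** Fix $M_t>0$ for $t\in\mathcal T'$. Put $\mathcal Q_T^{\mathrm R}\equiv0$ and, for $t=T,\dots,2$, $$Q_t^{\mathrm R}(x_{t-1};\xi_t)=\max_{\|\lambda_t\|_*\le M_t}\ \inf_{x_t\in\mathcal X_t,\,z_t\in\mathbb R^{d_{t-1}}} f_t(z_t,x_t;\xi_t)+\mathcal Q_t^{\mathrm R}(x_t)+\langle\lambda_t,x_{t-1}-z_t\rangle,$$ $$\mathcal Q_{t-1}^{\mathrm R}(x_{t-1})=\sup_{p_t\in\mathcal P_t}\mathbb E_{\xi_t\sim p_t}Q_t^{\mathrm R}(x_{t-1};\xi_t).$$ **Single stage subproblem oracles.** Let $\underline{\mathcal Q}_t,\overline{\mathcal Q}_t$ be lower semicontinuous convex functions with values in $\mathbb R\cup\{+\infty\}$ and $\underline{\mathcal Q}_t\le\mathcal Q_t^{\mathrm R}\le\overline{\mathcal Q}_t$ on $\mathcal X_t$ (in the algorithm $\underline{\mathcal Q}_t$ is always real-valued). *Initial stage oracle* $\mathscr O_1:(\underline{\mathcal Q}_1,\overline{\mathcal Q}_1)\mapsto(x_1;\gamma_1)$: returns an optimal solution $x_1$ of $\min_{x_1\in\mathcal X_1}f_1(x_0,x_1;\xi_1)+\underline{\mathcal Q}_1(x_1)$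 and $\gamma_1=\overline{\mathcal Q}_1(x_1)-\underline{\mathcal Q}_1(x_1)$. *Noninitial stage oracle* ($t\in\mathcal T'$) $\mathscr O_t:(x_{t-1},\underline{\mathcal Q}_t,\overline{\mathcal Q}_t)\mapsto(\mathcal V_{t-1},v_{t-1},x_t;\gamma_t)$: given $x_{t-1}\in\mathcal X_{t-1}$, returns some $x_t\in\mathcal X_t$, an $M_t$-Lipschitz affine function $\mathcal V_{t-1}$ and a value $v_{t-1}\in\mathbb R\cup\{+\infty\}$ such that $\mathcal V_{t-1}\le\mathcal Q_{t-1}^{\mathrm R}$ on $\mathcal X_{t-1}$, $v_{t-1}\ge\mathcal Q_{t-1}^{\mathrm R}(x_{t-1})$, and $v_{t-1}-\mathcal V_{t-1}(x_{t-1})\le\gamma_t:=\overline{\mathcal Q}_t(x_t)-\underline{\mathcal Q}_t(x_t)$. Any oracles satisfying these requirements may be used. **Notation.** $\mathrm{conv}\{h_1,h_2\}(x)=\sup_\lambda\inf_z\{\min\{h_1(z),h_2(z)\}+\langle\lambda,x-z\rangle\}$ (closed convex hull of the epigraphs). **CDDP algorithm.** Input: oracles $\mathscr O_t$, $t\in\mathcal T$, and $\varepsilon>0$. Initialize $\underline{\mathcal Q}_t^0=0$, $\overline{\mathcal Q}_t^0=+\infty$ for $t<T$; $\underline{\mathcal Q}_T^j=\overline{\mathcal Q}_T^j=0$ for all $j$; $i=1$. Evaluate $(x_1^1;\gamma_1^1)=\mathscr O_1(\underline{\mathcal Q}_1^0,\overline{\mathcal Q}_1^0)$; set $\mathrm{LB}=f_1(x_0,x_1^1;\xi_1)$,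 $\mathrm{UB}=+\infty$. While $\mathrm{UB}-\mathrm{LB}>\varepsilon$: (1) for $t=2,\dots,T$ evaluate $(\mathcal V_{t-1}^i,v_{t-1}^i,x_t^i;\gamma_t^i)=\mathscr O_t(x_{t-1}^i,\underline{\mathcal Q}_t^{i-1},\overline{\mathcal Q}_t^{i-1})$; (2) for $t=T,\dots,2$ set $\underline{\mathcal Q}_{t-1}^i=\max\{\underline{\mathcal Q}_{t-1}^{i-1},\mathcal V_{t-1}^i\}$ and $\overline{\mathcal Q}_{t-1}^i=\mathrm{conv}\{\overline{\mathcal Q}_{t-1}^{i-1},\,v_{t-1}^i+M_t\|\cdot-x_{t-1}^i\|\}$; (3) evaluate $(x_1^{i+1};\gamma_1^{i+1})=\mathscr O_1(\underline{\mathcal Q}_1^i,\overline{\mathcal Q}_1^i)$, set $\mathrm{LB}=f_1(x_0,x_1^{i+1};\xi_1)+\underline{\mathcal Q}_1^i(x_1^{i+1})$ and $\mathrm{UB}'=f_1(x_0,x_1^{i+1};\xi_1)+\overline{\mathcal Q}_1^i(x_1^{i+1})$; if $\mathrm{UB}'<\mathrm{UB}$, set $x_1^*=x_1^{i+1}$ and $\mathrm{UB}=\mathrm{UB}'$; then $i\leftarrow i+1$. The algorithm terminates when the while-loop ends and returns $x_1^*$. *)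

theory Defs
  imports "HOL-Probability.Probability" "HOL-Library.While_Combinator"
begin

text \<open>
  The dimensions vary with the stage, so \<open>\<real>\<^sup>n\<close> is the carrier of the library topology
  \<^const>\<open>Euclidean_space\<close>: functions \<^typ>\<open>nat \<Rightarrow> real\<close> that vanish from
  index \<open>n\<close> on. On these carriers the product topology of the function type (used below for
  compactness, limits and Borel sets) is the Euclidean one. The function type is not an instance of
  the vector space classes, so linear operations are written pointwise.
\<close>

type_synonym vec = "nat \<Rightarrow> real"

abbreviation Rn :: "nat \<Rightarrow> vec set"
  where "Rn n \<equiv> topspace (Euclidean_space n)"

definition vdiff :: "vec \<Rightarrow> vec \<Rightarrow> vec"
  where "vdiff x y = (\<lambda>i. x i - y i)"

definition vcomb :: "real \<Rightarrow> vec \<Rightarrow> vec \<Rightarrow> vec"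
  where "vcomb u x y = (\<lambda>i. u * x i + (1 - u) * y i)"

definition pairing :: "nat \<Rightarrow> vec \<Rightarrow> vec \<Rightarrow> real"
  where "pairing n l x = (\<Sum>i<n. l i * x i)"

definition is_norm :: "nat \<Rightarrow> (vec \<Rightarrow> real) \<Rightarrow> bool"
  where "is_norm n N \<longleftrightarrow>
    (\<forall>x\<in>Rn n. 0 \<le> N x \<and> (N x = 0 \<longleftrightarrow> x = (\<lambda>i. 0))) \<and>
    (\<forall>x\<in>Rn n. \<forall>c. N (\<lambda>i. c * x i) = \<bar>c\<bar> * N x) \<and>
    (\<forall>x\<in>Rn n. \<forall>y\<in>Rn n. N (\<lambda>i. x i + y i) \<le> N x + N y)"

definition dual_norm :: "nat \<Rightarrow> (vec \<Rightarrow> real) \<Rightarrow> vec \<Rightarrow> real"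
  where "dual_norm n N l = Sup {pairing n l x | x. x \<in> Rn n \<and> N x \<le> 1}"

definition convex_set :: "vec set \<Rightarrow> bool"
  where "convex_set S \<longleftrightarrow> (\<forall>x\<in>S. \<forall>y\<in>S. \<forall>u\<in>{0..1}. vcomb u x y \<in> S)"

definition convex_fun :: "vec set \<Rightarrow> (vec \<Rightarrow> ereal) \<Rightarrow> bool"
  where "convex_fun S g \<longleftrightarrow>
    (\<forall>x\<in>S. \<forall>y\<in>S. \<forall>u\<in>{0<..<1}.
       g (vcomb u x y) \<le> ereal u * g x + ereal (1 - u) * g y)"

definition lsc_on :: "'a::topological_space set \<Rightarrow> ('a \<Rightarrow> ereal) \<Rightarrow> bool"
  where "lsc_on S g \<longleftrightarrow> (\<forall>x\<in>S. g x \<le> Liminf (at x within S) g)"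

definition affine_fun :: "nat \<Rightarrow> (vec \<Rightarrow> real) \<Rightarrow> bool"
  where "affine_fun n V \<longleftrightarrow> (\<exists>a\<in>Rn n. \<exists>c. \<forall>x\<in>Rn n. V x = pairing n a x + c)"

definition lipschitz_fun :: "nat \<Rightarrow> (vec \<Rightarrow> real) \<Rightarrow> real \<Rightarrow> (vec \<Rightarrow> real) \<Rightarrow> bool"
  where "lipschitz_fun n N L V \<longleftrightarrow>
    (\<forall>x\<in>Rn n. \<forall>y\<in>Rn n. \<bar>V x - V y\<bar> \<le> L * N (vdiff x y))"

definition conv_hull2 :: "nat \<Rightarrow> (vec \<Rightarrow> ereal) \<Rightarrow> (vec \<Rightarrow> ereal) \<Rightarrow> vec \<Rightarrow> ereal"
  where "conv_hull2 n h1 h2 x =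
    (SUP l\<in>Rn n. INF z\<in>Rn n. min (h1 z) (h2 z) + ereal (pairing n l (vdiff x z)))"

text \<open>
  Data of a multistage problem. Stage-indexed fields are meaningful only for stages up to
  \<open>horizon\<close>; \<open>nrm t\<close> is the norm on \<open>\<real>\<close> to the power \<open>dimX t\<close>;
  \<open>cost t z y \<xi>\<close> is \<open>f\<^sub>t(z, y; \<xi>)\<close>;
  \<open>Lip t\<close> is the regularization bound \<open>M\<^sub>t\<close>.
\<close>

record problem =
  horizon :: nat
  dimX :: "nat \<Rightarrow> nat"
  dimXi :: "nat \<Rightarrow> nat"
  Xset :: "nat \<Rightarrow> vec set"
  Xiset :: "nat \<Rightarrow> vec set"
  xinit :: vec
  xiinit :: vec
  cost :: "nat \<Rightarrow> vec \<Rightarrow> vec \<Rightarrow> vec \<Rightarrow> ereal"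
  Prob :: "nat \<Rightarrow> vec measure set"
  nrm :: "nat \<Rightarrow> vec \<Rightarrow> real"
  Lip :: "nat \<Rightarrow> real"

definition well_posed :: "problem \<Rightarrow> bool"
  where "well_posed pr \<longleftrightarrow>
    2 \<le> horizon pr \<and>
    xinit pr \<in> Rn (dimX pr 0) \<and> Xset pr 0 = {xinit pr} \<and> Xiset pr 1 = {xiinit pr} \<and>
    (\<forall>t\<in>{0..horizon pr}. is_norm (dimX pr t) (nrm pr t)) \<and>
    (\<forall>t\<in>{1..horizon pr}.
       Xset pr t \<subseteq> Rn (dimX pr t) \<and> Xset pr t \<noteq> {} \<and> compact (Xset pr t) \<and> convex_set (Xset pr t) \<and>
       Xiset pr t \<subseteq> Rn (dimXi pr t) \<and> Xiset pr t \<noteq> {} \<and> Xiset pr t \<in> sets borel \<and>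
       (convex_set (Xiset pr t) \<or> finite (Xiset pr t)) \<and>
       (\<forall>z\<in>Rn (dimX pr (t - 1)). \<forall>y\<in>Rn (dimX pr t). \<forall>\<xi>\<in>Xiset pr t. 0 \<le> cost pr t z y \<xi>) \<and>
       lsc_on (Rn (dimX pr (t - 1)) \<times> Rn (dimX pr t) \<times> Xiset pr t)
         (\<lambda>(z, y, \<xi>). cost pr t z y \<xi>) \<and>
       (\<forall>\<xi>\<in>Xiset pr t. \<forall>z\<in>Rn (dimX pr (t - 1)). \<forall>z'\<in>Rn (dimX pr (t - 1)).
          \<forall>y\<in>Rn (dimX pr t). \<forall>y'\<in>Rn (dimX pr t). \<forall>u\<in>{0<..<1}.
            cost pr t (vcomb u z z') (vcomb u y y') \<xi>
              \<le> ereal u * cost pr t z y \<xi> + ereal (1 - u) * cost pr t z' y' \<xi>)) \<and>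
    (\<forall>t\<in>{2..horizon pr}.
       Prob pr t \<noteq> {} \<and>
       (\<forall>p\<in>Prob pr t. prob_space p \<and> sets p = sets (restrict_space borel (Xiset pr t))) \<and>
       0 < Lip pr t) \<and>
    (\<exists>x1\<in>Xset pr 1. cost pr 1 (xinit pr) x1 (xiinit pr) < \<infinity>)"

text \<open>
  The supremum over the dual ball is a maximum, since the inner infimum is upper semicontinuous in
  \<open>l\<close>. The stage value is nonnegative (take \<open>l = 0\<close>), so its expectation is a
  nonnegative Lebesgue integral.
\<close>

definition stage_value :: "problem \<Rightarrow> nat \<Rightarrow> (vec \<Rightarrow> ereal) \<Rightarrow> vec \<Rightarrow> vec \<Rightarrow> ereal"
  where "stage_value pr t Q x \<xi> =
    (SUP l\<in>{l \<in> Rn (dimX pr (t - 1)). dual_norm (dimX pr (t - 1)) (nrm pr (t - 1)) l \<le> Lip pr t}.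
       INF (y, z)\<in>Xset pr t \<times> Rn (dimX pr (t - 1)).
         cost pr t z y \<xi> + Q y + ereal (pairing (dimX pr (t - 1)) l (vdiff x z)))"

function cost_to_go :: "problem \<Rightarrow> nat \<Rightarrow> vec \<Rightarrow> ereal"
  where "cost_to_go pr t =
    (if t < horizon pr
     then (\<lambda>x. SUP p\<in>Prob pr (Suc t).
       enn2ereal (\<integral>\<^sup>+ \<xi>. e2ennreal (stage_value pr (Suc t) (cost_to_go pr (Suc t)) x \<xi>) \<partial>p))
     else (\<lambda>x. 0))"
  by auto
termination by (relation "Wellfounded.measure (\<lambda>(pr, t). horizon pr - t)") auto

declare cost_to_go.simps [simp del]

type_synonym initial_oracle = "(vec \<Rightarrow> ereal) \<Rightarrow> (vec \<Rightarrow> ereal) \<Rightarrow> vec \<times> ereal"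

type_synonym stage_oracle =
  "nat \<Rightarrow> vec \<Rightarrow> (vec \<Rightarrow> ereal) \<Rightarrow> (vec \<Rightarrow> ereal) \<Rightarrow> (vec \<Rightarrow> real) \<times> ereal \<times> vec \<times> ereal"

text \<open>
  The oracles have to meet their requirements only on these inputs.
\<close>

definition valid_bounds :: "problem \<Rightarrow> nat \<Rightarrow> (vec \<Rightarrow> ereal) \<Rightarrow> (vec \<Rightarrow> ereal) \<Rightarrow> bool"
  where "valid_bounds pr t lo up \<longleftrightarrow>
    (\<forall>g\<in>{lo, up}. lsc_on (Rn (dimX pr t)) g \<and> convex_fun (Rn (dimX pr t)) g \<and>
       (\<forall>x\<in>Rn (dimX pr t). g x \<noteq> -\<infinity>)) \<and>
    (\<forall>x\<in>Xset pr t. lo x \<le> cost_to_go pr t x \<and> cost_to_go pr t x \<le> up x)"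

definition is_initial_oracle :: "problem \<Rightarrow> initial_oracle \<Rightarrow> bool"
  where "is_initial_oracle pr O1 \<longleftrightarrow>
    (\<forall>lo up x \<gamma>. valid_bounds pr 1 lo up \<and> O1 lo up = (x, \<gamma>) \<longrightarrow>
       x \<in> Xset pr 1 \<and>
       (\<forall>y\<in>Xset pr 1. cost pr 1 (xinit pr) x (xiinit pr) + lo x \<le> cost pr 1 (xinit pr) y (xiinit pr) + lo y) \<and>
       \<gamma> = up x - lo x)"

definition is_stage_oracle :: "problem \<Rightarrow> stage_oracle \<Rightarrow> nat \<Rightarrow> bool"
  where "is_stage_oracle pr Orc t \<longleftrightarrow>
    (\<forall>x lo up V v y \<gamma>.
       x \<in> Xset pr (t - 1) \<and> valid_bounds pr t lo up \<and> Orc t x lo up = (V, v, y, \<gamma>) \<longrightarrow>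
       y \<in> Xset pr t \<and>
       affine_fun (dimX pr (t - 1)) V \<and>
       lipschitz_fun (dimX pr (t - 1)) (nrm pr (t - 1)) (Lip pr t) V \<and>
       v \<noteq> -\<infinity> \<and>
       (\<forall>w\<in>Xset pr (t - 1). ereal (V w) \<le> cost_to_go pr (t - 1) w) \<and>
       cost_to_go pr (t - 1) x \<le> v \<and>
       v - ereal (V x) \<le> \<gamma> \<and>
       \<gamma> = up y - lo y)"

text \<open>
  The state of the algorithm when the loop condition is tested for iteration \<open>i\<close>:
  \<open>under\<close> and \<open>over\<close> hold the approximations with superscript \<open>i - 1\<close>,
  and \<open>point 1\<close> is the current first-stage solution. The other components of \<open>point\<close>,
  \<open>cut\<close> and \<open>val\<close> (at stage \<open>t\<close>) are overwritten in the forward pass.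
  \<open>evals\<close> counts all oracle evaluations so far.
\<close>

record state =
  point :: "nat \<Rightarrow> vec"
  cut :: "nat \<Rightarrow> vec \<Rightarrow> real"
  val :: "nat \<Rightarrow> ereal"
  under :: "nat \<Rightarrow> vec \<Rightarrow> ereal"
  over :: "nat \<Rightarrow> vec \<Rightarrow> ereal"
  LB :: ereal
  UB :: ereal
  best :: "vec option"
  evals :: nat

definition cddp_init :: "problem \<Rightarrow> initial_oracle \<Rightarrow> state"
  where "cddp_init pr O1 =
    (let lo = (\<lambda>t x. 0);
         up = (\<lambda>t x. if t < horizon pr then \<infinity> else 0);
         (x, \<gamma>) = O1 (lo 1) (up 1)
     in \<lparr> point = (\<lambda>t. x), cut = (\<lambda>t x. 0), val = (\<lambda>t. 0), under = lo, over = up,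
          LB = cost pr 1 (xinit pr) x (xiinit pr), UB = \<infinity>, best = None, evals = 1 \<rparr>)"

definition forward_step :: "stage_oracle \<Rightarrow> nat \<Rightarrow> state \<Rightarrow> state"
  where "forward_step Orc t s =
    (let (V, v, x, \<gamma>) = Orc t (point s (t - 1)) (under s t) (over s t)
     in s \<lparr> point := (point s)(t := x), cut := (cut s)(t - 1 := V), val := (val s)(t - 1 := v),
            evals := Suc (evals s) \<rparr>)"

definition backward_step :: "problem \<Rightarrow> nat \<Rightarrow> state \<Rightarrow> state"
  where "backward_step pr t s =
    s \<lparr> under := (under s)(t - 1 := (\<lambda>x. max (under s (t - 1) x) (ereal (cut s (t - 1) x)))),
        over := (over s)(t - 1 := conv_hull2 (dimX pr (t - 1)) (over s (t - 1))
          (\<lambda>x. val s (t - 1) + ereal (Lip pr t * nrm pr (t - 1) (vdiff x (point s (t - 1)))))) \<rparr>"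

definition initial_step :: "problem \<Rightarrow> initial_oracle \<Rightarrow> state \<Rightarrow> state"
  where "initial_step pr O1 s =
    (let (x, \<gamma>) = O1 (under s 1) (over s 1);
         c = cost pr 1 (xinit pr) x (xiinit pr);
         UB' = c + over s 1 x;
         s' = s \<lparr> point := (point s)(1 := x), LB := c + under s 1 x, evals := Suc (evals s) \<rparr>
     in if UB' < UB s then s' \<lparr> best := Some x, UB := UB' \<rparr> else s')"

definition cddp_iteration :: "problem \<Rightarrow> initial_oracle \<Rightarrow> stage_oracle \<Rightarrow> state \<Rightarrow> state"
  where "cddp_iteration pr O1 Orc s =
    initial_step pr O1
      (fold (backward_step pr) (rev [2..<Suc (horizon pr)])
        (fold (forward_step Orc) [2..<Suc (horizon pr)] s))"

text \<open>The result is \<^const>\<open>None\<close> exactly if the loop does not terminate.\<close>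

definition cddp :: "problem \<Rightarrow> initial_oracle \<Rightarrow> stage_oracle \<Rightarrow> real \<Rightarrow> state option"
  where "cddp pr O1 Orc \<epsilon> =
    while_option (\<lambda>s. ereal \<epsilon> < UB s - LB s) (cddp_iteration pr O1 Orc) (cddp_init pr O1)"

end

theory Submission
  imports Defs
begin

text \<open>
  The loop makes one more round only if, at the current first-stage point, the upper and the lower
  approximation are more than \<open>\<epsilon> = \<delta>\<^sub>1\<close> apart. At the last stage both approximations are zero, so
  the gap there is \<open>0 = \<delta>\<^sub>T\<close>. Along the trial points \<open>x\<^sub>1, \<dots>, x\<^sub>T\<close> of the forward pass there is
  therefore a stage \<open>t\<close> whose gap exceeds \<open>\<delta>\<^sub>t\<close> at \<open>x\<^sub>t\<close> while the gap of the next stage is at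
  most \<open>\<delta>\<^bsub>t+1\<^esub>\<close> (\<open>saturated_stage_exists\<close>). The oracle of that next stage returns a
  cut and a value at \<open>x\<^sub>t\<close> that differ by no more than its gap. With \<open>M\<close> the Lipschitz constant of
  the cut and the slope of the cone erected over the value, the gap of stage \<open>t\<close> at \<open>w\<close> is from then
  on at most \<open>\<delta>\<^bsub>t+1\<^esub>\<close> plus \<open>2 M\<close> times the distance of \<open>w\<close> from \<open>x\<^sub>t\<close> (\<open>iteration\<close>).
  A later round that selects the same stage must thus have its trial point at distance more
  than \<open>(\<delta>\<^sub>t - \<delta>\<^bsub>t+1\<^esub>) / (2 M)\<close> from the earlier one. Comparing volumes of balls limits
  the number of such points in a ball of diameter \<open>D\<^sub>t\<close> (\<open>packing_bound\<close>); summing over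
  the stages limits the number of rounds (\<open>iteration_bound\<close>), and a round costs \<open>T\<close> evaluations.

  The oracles promise something only if their inputs are lower semicontinuous, convex and
  enclose the cost-to-go function, and most of the work is to keep these properties alive. Cuts
  do no harm to the lower approximation. The new upper approximation is the closed convex
  hull of a minimum; it stays above the cost-to-go function because the latter is convex on the whole
  space and has the cone as a majorant, so that a subgradient of it is an admissible
  dual vector (\<open>subgradient_exists\<close>, \<open>conv_hull2_ge_convex\<close>).

  Convexity of the cost-to-go function rests on measurability of the stage value in the random
  parameter: the integral of a nonmeasurable function is a lower integral, which is not subadditive. Measurability
  is not visible from the supremum over the uncountable dual ball. Duality rewrites it as an infimal
  convolution with a multiple of the norm (\<open>dual_ball_minimax\<close>), which is a countable infimum of
  infima of lower semicontinuous functions over compact sets and hence measurable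
  (\<open>borel_measurable_infimal_convolution\<close>).
\<close>

section \<open>Vectors, pairings and norms\<close>

lemma Rn_iff: "x \<in> Rn n \<longleftrightarrow> (\<forall>i\<ge>n. x i = 0)"
  by (simp add: topspace_Euclidean_space)

lemma Rn_zero: "(\<lambda>i. 0) \<in> Rn n"
  and Rn_add: "x \<in> Rn n \<Longrightarrow> y \<in> Rn n \<Longrightarrow> (\<lambda>i. x i + y i) \<in> Rn n"
  and Rn_scale: "x \<in> Rn n \<Longrightarrow> (\<lambda>i. c * x i) \<in> Rn n"
  and Rn_vdiff: "x \<in> Rn n \<Longrightarrow> y \<in> Rn n \<Longrightarrow> vdiff x y \<in> Rn n"
  and Rn_vcomb: "x \<in> Rn n \<Longrightarrow> y \<in> Rn n \<Longrightarrow> vcomb u x y \<in> Rn n"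
  by (auto simp: Rn_iff vdiff_def vcomb_def)

lemma closed_Rn: "closed (Rn n)"
proof -
  have "Rn n = (\<Inter>i\<in>{n..}. {x. x i = 0})" by (auto simp: Rn_iff)
  moreover have "closed {x::vec. x i = 0}" for i
    by (intro closed_Collect_eq continuous_intros continuous_on_product_coordinates)
  ultimately show ?thesis by auto
qed

lemma pairing_vdiff: "pairing n l (vdiff x z) = pairing n l x - pairing n l z"
  by (simp add: pairing_def vdiff_def algebra_simps sum_subtractf)

lemma pairing_scale: "pairing n l (\<lambda>i. c * x i) = c * pairing n l x"
  by (simp add: pairing_def algebra_simps sum_distrib_left)

lemma pairing_vcomb: "pairing n l (vcomb u x y) = u * pairing n l x + (1 - u) * pairing n l y"
  by (simp add: pairing_def vcomb_def algebra_simps sum.distrib sum_distrib_left sum_subtractf)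

lemma continuous_on_pairing: "continuous_on S (pairing n l)"
  unfolding pairing_def
  by (intro continuous_on_sum continuous_on_mult continuous_on_const)
     (rule continuous_on_subset[OF continuous_on_product_coordinates], simp)

lemma compact_box: "compact {x \<in> Rn n. \<forall>i. \<bar>x i\<bar> \<le> r}"
proof -
  have "compactin (product_topology (\<lambda>i::nat. euclidean) UNIV) (PiE UNIV (\<lambda>i. {-r..r::real}))"
    by (subst compactin_PiE) auto
  then have "compact (PiE UNIV (\<lambda>i::nat. {-r..r::real}))"
    by (simp add: euclidean_product_topology)
  then have "compact (Rn n \<inter> PiE UNIV (\<lambda>i::nat. {-r..r::real}))"
    using closed_Rn by (rule closed_Int_compact[rotated])
  moreover have "{x \<in> Rn n. \<forall>i. \<bar>x i\<bar> \<le> r} = Rn n \<inter> PiE UNIV (\<lambda>i::nat. {-r..r::real})"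
    by (auto simp: abs_le_iff PiE_iff) (metis minus_le_iff)+
  ultimately show ?thesis by simp
qed

locale Rn_norm =
  fixes n :: nat and N :: "vec \<Rightarrow> real"
  assumes norm: "is_norm n N"
begin

lemma nonneg: "x \<in> Rn n \<Longrightarrow> 0 \<le> N x"
  and eq_0_iff: "x \<in> Rn n \<Longrightarrow> N x = 0 \<longleftrightarrow> x = (\<lambda>i. 0)"
  and scale: "x \<in> Rn n \<Longrightarrow> N (\<lambda>i. c * x i) = \<bar>c\<bar> * N x"
  and triangle: "x \<in> Rn n \<Longrightarrow> y \<in> Rn n \<Longrightarrow> N (\<lambda>i. x i + y i) \<le> N x + N y"
  using norm unfolding is_norm_def by blast+

lemma vdiff_self: "N (vdiff x x) = 0"
  using eq_0_iff[OF Rn_zero] by (simp add: vdiff_def)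

lemma vdiff_commute: "x \<in> Rn n \<Longrightarrow> y \<in> Rn n \<Longrightarrow> N (vdiff x y) = N (vdiff y x)"
  using scale[of "vdiff x y" "-1"] by (simp add: Rn_vdiff) (simp add: vdiff_def)

lemma vdiff_triangle:
  "x \<in> Rn n \<Longrightarrow> y \<in> Rn n \<Longrightarrow> z \<in> Rn n \<Longrightarrow> N (vdiff x z) \<le> N (vdiff x y) + N (vdiff y z)"
  using triangle[of "vdiff x y" "vdiff y z"] by (simp add: Rn_vdiff) (simp add: vdiff_def)

lemma coordinate_bound: "\<exists>C\<ge>0. \<forall>x\<in>Rn n. N x \<le> C * (\<Sum>i<n. \<bar>x i\<bar>)"
proof -
  define e where "e i = (\<lambda>j::nat. if j = i then 1 else 0::real)" for i
  define C where "C = (\<Sum>i<n. N (e i))"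
  have e: "e i \<in> Rn n" if "i < n" for i using that by (auto simp: e_def Rn_iff)
  have *: "N (\<lambda>i. if i < k then x i else 0) \<le> (\<Sum>i<k. \<bar>x i\<bar> * N (e i))"
    if "x \<in> Rn n" "k \<le> n" for x k
    using that(2)
  proof (induction k)
    case 0 then show ?case using eq_0_iff[OF Rn_zero] by simp
  next
    case (Suc k)
    have eq: "(\<lambda>i. if i < Suc k then x i else 0) = (\<lambda>i. (if i < k then x i else 0) + x k * e k i)"
      by (auto simp: e_def less_Suc_eq)
    have "N (\<lambda>i. if i < Suc k then x i else 0) \<le> N (\<lambda>i. if i < k then x i else 0) + N (\<lambda>i. x k * e k i)"
      unfolding eq using Suc.prems e[of k] by (intro triangle Rn_scale) (auto simp: Rn_iff)
    also have "\<dots> \<le> (\<Sum>i<Suc k. \<bar>x i\<bar> * N (e i))"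
      using Suc scale[OF e[of k]] by auto
    finally show ?case .
  qed
  have "N x \<le> C * (\<Sum>i<n. \<bar>x i\<bar>)" if x: "x \<in> Rn n" for x
  proof -
    have "x = (\<lambda>i. if i < n then x i else 0)" using x by (auto simp: Rn_iff)
    then have "N x \<le> (\<Sum>i<n. \<bar>x i\<bar> * N (e i))" using *[OF x order_refl] by simp
    also have "\<dots> \<le> (\<Sum>i<n. \<bar>x i\<bar> * C)"
      unfolding C_def using nonneg e
      by (intro sum_mono mult_left_mono member_le_sum) auto
    finally show ?thesis by (simp add: sum_distrib_left mult.commute)
  qed
  moreover have "C \<ge> 0" unfolding C_def using nonneg e by (auto intro: sum_nonneg)
  ultimately show ?thesis by blast
qed

lemma tendsto_vdiff: "x \<in> Rn n \<Longrightarrow> ((\<lambda>y. N (vdiff y x)) \<longlongrightarrow> 0) (at x within Rn n)"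
proof -
  assume x: "x \<in> Rn n"
  obtain C where C: "C \<ge> 0" "\<forall>x\<in>Rn n. N x \<le> C * (\<Sum>i<n. \<bar>x i\<bar>)" using coordinate_bound by blast
  have c: "continuous_on (Rn n) (\<lambda>y. C * (\<Sum>i<n. \<bar>y i - x i\<bar>))"
    by (intro continuous_intros; rule continuous_on_subset[OF continuous_on_product_coordinates]; simp)
  have "((\<lambda>y. C * (\<Sum>i<n. \<bar>y i - x i\<bar>)) \<longlongrightarrow> 0) (at x within Rn n)"
    using c x unfolding continuous_on_def by fastforce
  then show ?thesis
  proof (rule Lim_null_comparison[rotated])
    show "\<forall>\<^sub>F y in at x within Rn n. norm (N (vdiff y x)) \<le> C * (\<Sum>i<n. \<bar>y i - x i\<bar>)"
      using C(2) nonneg x by (auto simp: eventually_at_filter Rn_vdiff intro!: always_eventually)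
        (simp add: vdiff_def Rn_vdiff[unfolded vdiff_def])
  qed
qed

lemma reverse_triangle: "x \<in> Rn n \<Longrightarrow> y \<in> Rn n \<Longrightarrow> \<bar>N y - N x\<bar> \<le> N (vdiff y x)"
  using triangle[of x "vdiff y x"] triangle[of y "vdiff x y"] vdiff_commute[of x y]
  by (simp add: Rn_vdiff) (simp add: vdiff_def)

lemma continuous_on_norm: "continuous_on (Rn n) N"
  unfolding continuous_on_def
proof
  fix x assume x: "x \<in> Rn n"
  have "((\<lambda>y. N y - N x) \<longlongrightarrow> 0) (at x within Rn n)"
    using tendsto_vdiff[OF x]
    by (rule Lim_null_comparison[rotated])
       (use reverse_triangle x in \<open>auto simp: eventually_at_filter intro!: always_eventually\<close>)
  then show "(N \<longlongrightarrow> N x) (at x within Rn n)" by (simp add: Lim_null[symmetric])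
qed

text \<open>
  The norm has a positive minimum on the unit sphere of the maximum norm, which is compact;
  homogeneity does the rest.
\<close>

lemma coercive: "\<exists>c>0. \<forall>x\<in>Rn n. \<forall>i. \<bar>x i\<bar> \<le> c * N x"
proof (cases "n = 0")
  case True then show ?thesis by (intro exI[of _ 1]) (auto simp: Rn_iff nonneg)
next
  case False
  define S where "S = {x \<in> Rn n. \<forall>i. \<bar>x i\<bar> \<le> 1} \<inter> (\<Union>i<n. {x. \<bar>x i\<bar> = 1})"
  have "closed {x::vec. \<bar>x i\<bar> = 1}" for i
    by (intro closed_Collect_eq continuous_intros continuous_on_product_coordinates)
  then have S: "compact S" unfolding S_def
    by (intro compact_Int_closed[OF compact_box] closed_UN) auto
  have "(\<lambda>i. if i = 0 then 1 else 0) \<in> S" using False by (auto simp: S_def Rn_iff)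
  then have "S \<noteq> {}" by blast
  moreover have "continuous_on S N"
    by (rule continuous_on_subset[OF continuous_on_norm]) (auto simp: S_def)
  ultimately obtain m where m: "m \<in> S" "\<And>x. x \<in> S \<Longrightarrow> N m \<le> N x"
    using continuous_attains_inf[OF S] by blast
  have mR: "m \<in> Rn n" using m(1) by (simp add: S_def)
  have "m \<noteq> (\<lambda>i. 0)" using m(1) by (auto simp: S_def)
  then have pos: "N m > 0" using nonneg[OF mR] eq_0_iff[OF mR] by linarith
  have "\<bar>x i\<bar> \<le> 1 / N m * N x" if x: "x \<in> Rn n" for x i
  proof -
    define r where "r = Max ((\<lambda>i. \<bar>x i\<bar>) ` {..<n})"
    have le: "\<bar>x i\<bar> \<le> r" if "i < n" for i unfolding r_def using that by (intro Max_ge) auto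
    have "r \<in> (\<lambda>i. \<bar>x i\<bar>) ` {..<n}" unfolding r_def using False by (intro Max_in) auto
    then obtain j where j: "j < n" "\<bar>x j\<bar> = r" by auto
    have le: "\<bar>x i\<bar> \<le> r" for i
      using le[of i] j x by (cases "i < n") (auto simp: Rn_iff)
    show ?thesis
    proof (cases "r = 0")
      case True then show ?thesis using le[of i] nonneg[OF x] pos by simp
    next
      case False
      then have r: "r > 0" using j by auto
      have "(\<lambda>i. (1/r) * x i) \<in> S" using r le j x
        by (auto simp: S_def Rn_iff abs_mult divide_simps)
      then have "N m \<le> (1/r) * N x" using m(2) scale[OF x, of "1/r"] r by fastforce
      then have "r \<le> 1 / N m * N x" using r pos by (simp add: field_simps)
      then show ?thesis using le[of i] by linarith
    qed
  qed
  then show ?thesis using pos by (intro exI[of _ "1 / N m"]) auto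
qed

lemma pairing_bounded: "\<exists>K\<ge>0. \<forall>x\<in>Rn n. \<bar>pairing n l x\<bar> \<le> K * N x"
proof -
  obtain c where c: "c > 0" "\<forall>x\<in>Rn n. \<forall>i. \<bar>x i\<bar> \<le> c * N x" using coercive by blast
  have "\<bar>pairing n l x\<bar> \<le> (\<Sum>i<n. \<bar>l i\<bar> * c) * N x" if x: "x \<in> Rn n" for x
  proof -
    have "\<bar>pairing n l x\<bar> \<le> (\<Sum>i<n. \<bar>l i\<bar> * \<bar>x i\<bar>)"
      unfolding pairing_def by (rule order_trans[OF sum_abs]) (simp add: abs_mult)
    also have "\<dots> \<le> (\<Sum>i<n. \<bar>l i\<bar> * (c * N x))"
      using c x by (intro sum_mono mult_left_mono) auto
    finally show ?thesis by (simp add: sum_distrib_right mult.assoc)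
  qed
  then show ?thesis using c by (intro exI[of _ "\<Sum>i<n. \<bar>l i\<bar> * c"]) (auto intro!: sum_nonneg)
qed

text \<open>
  The dual norm is a supremum of real numbers and means what it should only because it is taken over
  a bounded set of values, which is where coercivity enters.
\<close>

lemma dual_norm_le_iff:
  assumes "M \<ge> 0"
  shows "dual_norm n N l \<le> M \<longleftrightarrow> (\<forall>x\<in>Rn n. pairing n l x \<le> M * N x)"
proof -
  let ?A = "{pairing n l x | x. x \<in> Rn n \<and> N x \<le> 1}"
  obtain K where K: "K \<ge> 0" "\<forall>x\<in>Rn n. \<bar>pairing n l x\<bar> \<le> K * N x" using pairing_bounded by blast
  have ne: "?A \<noteq> {}" using eq_0_iff[OF Rn_zero] Rn_zero by fastforce
  have bdd: "bdd_above ?A"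
  proof (rule bdd_aboveI)
    fix a assume "a \<in> ?A"
    then obtain x where x: "a = pairing n l x" "x \<in> Rn n" "N x \<le> 1" by blast
    have "a \<le> K * N x" using K x by fastforce
    also have "\<dots> \<le> K" using mult_left_mono[OF x(3) K(1)] by simp
    finally show "a \<le> K" .
  qed
  show ?thesis
  proof
    assume le: "dual_norm n N l \<le> M"
    show "\<forall>x\<in>Rn n. pairing n l x \<le> M * N x"
    proof
      fix x assume x: "x \<in> Rn n"
      show "pairing n l x \<le> M * N x"
      proof (cases "N x = 0")
        case True then show ?thesis using eq_0_iff[OF x] by (simp add: pairing_def)
      next
        case False
        then have p: "N x > 0" using nonneg[OF x] by linarith
        have "pairing n l (\<lambda>i. (1 / N x) * x i) \<in> ?A"
          using p scale[OF x, of "1 / N x"] Rn_scale[OF x, of "1 / N x"] by fastforce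
        then have "pairing n l (\<lambda>i. (1 / N x) * x i) \<le> M"
          using le cSup_upper[OF _ bdd] unfolding dual_norm_def by fastforce
        then show ?thesis using p unfolding pairing_scale by (simp add: field_simps)
      qed
    qed
  next
    assume *: "\<forall>x\<in>Rn n. pairing n l x \<le> M * N x"
    have "a \<le> M" if a: "a \<in> ?A" for a
    proof -
      obtain x where x: "a = pairing n l x" "x \<in> Rn n" "N x \<le> 1" using a by blast
      have "a \<le> M * N x" using * x by blast
      also have "\<dots> \<le> M" using mult_left_mono[OF x(3) assms] by simp
      finally show ?thesis .
    qed
    then show "dual_norm n N l \<le> M" unfolding dual_norm_def using ne by (intro cSup_least) auto
  qed
qed

end

section \<open>Lower semicontinuous and convex functions\<close>

text \<open>
  Adding a finite number is invertible, hence commutes with every infimum, also with an empty or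
  infinite one.
\<close>

lemma ereal_INF_add_real: "(INF z\<in>A. f z + ereal a) = (INF z\<in>A. f z) + ereal a"
proof (cases "A = {}")
  case True then show ?thesis by (simp add: top_ereal_def)
next
  case False
  have *: "(INF z\<in>A. g z) + ereal b \<le> (INF z\<in>A. g z + ereal b)" for g b
    by (intro INF_greatest add_right_mono INF_lower)
  have "(INF z\<in>A. f z + ereal a) + ereal (- a) + ereal a \<le> (INF z\<in>A. f z + ereal a + ereal (- a)) + ereal a"
    by (intro add_right_mono *)
  then have "(INF z\<in>A. f z + ereal a) \<le> (INF z\<in>A. f z) + ereal a"
    by (simp add: add.assoc)
  then show ?thesis using *[of f a] by (intro antisym)
qed

text \<open>
  In terms of open superlevel sets the closure properties of lower semicontinuity become
  set algebra.
\<close>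

lemma lsc_on_iff_openin:
  "lsc_on S g \<longleftrightarrow> (\<forall>a. openin (top_of_set S) {x \<in> S. a < g x})"
proof
  assume l: "lsc_on S g"
  show "\<forall>a. openin (top_of_set S) {x \<in> S. a < g x}"
  proof
    fix a
    have "\<exists>U. openin (top_of_set S) U \<and> x \<in> U \<and> U \<subseteq> {x \<in> S. a < g x}" if "x \<in> {x \<in> S. a < g x}" for x
    proof -
      have "\<forall>\<^sub>F y in at x within S. a < g y"
        using l that unfolding lsc_on_def le_Liminf_iff by auto
      then obtain U where "open U" "x \<in> U" "\<forall>y\<in>U. y \<noteq> x \<longrightarrow> y \<in> S \<longrightarrow> a < g y"
        unfolding eventually_at_topological by blast
      then show ?thesis using that by (intro exI[of _ "S \<inter> U"]) (auto simp: openin_open)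
    qed
    then show "openin (top_of_set S) {x \<in> S. a < g x}" by (subst openin_subopen) blast
  qed
next
  assume o: "\<forall>a. openin (top_of_set S) {x \<in> S. a < g x}"
  show "lsc_on S g"
    unfolding lsc_on_def le_Liminf_iff
  proof (intro ballI allI impI)
    fix x a assume x: "x \<in> S" "a < g x"
    obtain U where "open U" "{x \<in> S. a < g x} = S \<inter> U" using o unfolding openin_open by blast
    then show "\<forall>\<^sub>F y in at x within S. a < g y"
      unfolding eventually_at_topological using x by blast
  qed
qed

lemma lsc_on_const: "lsc_on S (\<lambda>x. c)"
  unfolding lsc_on_iff_openin proof
  fix a show "openin (top_of_set S) {x \<in> S. a < c}" by (cases "a < c") auto
qed

lemma lsc_on_cong: "(\<And>x. x \<in> S \<Longrightarrow> f x = g x) \<Longrightarrow> lsc_on S f \<Longrightarrow> lsc_on S g"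
  unfolding lsc_on_iff_openin by (simp cong: conj_cong)

lemma lsc_on_SUP: "(\<And>i. i \<in> I \<Longrightarrow> lsc_on S (f i)) \<Longrightarrow> lsc_on S (\<lambda>x. SUP i\<in>I. f i x)"
proof -
  assume *: "\<And>i. i \<in> I \<Longrightarrow> lsc_on S (f i)"
  have "{x \<in> S. a < (SUP i\<in>I. f i x)} = (\<Union>i\<in>I. {x \<in> S. a < f i x})" for a
    by (auto simp: less_SUP_iff)
  then show ?thesis using * unfolding lsc_on_iff_openin by auto
qed

lemma lsc_on_max: "lsc_on S f \<Longrightarrow> lsc_on S g \<Longrightarrow> lsc_on S (\<lambda>x. max (f x) (g x))"
proof -
  assume *: "lsc_on S f" "lsc_on S g"
  have "{x \<in> S. a < max (f x) (g x)} = {x \<in> S. a < f x} \<union> {x \<in> S. a < g x}" for a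
    by (auto simp: less_max_iff_disj)
  then show ?thesis using * unfolding lsc_on_iff_openin by auto
qed

lemma lsc_on_compose:
  assumes "lsc_on S g" "continuous_on T h" "h ` T \<subseteq> S"
  shows "lsc_on T (\<lambda>x. g (h x))"
  unfolding lsc_on_iff_openin
proof
  fix a
  have "openin (top_of_set T) (T \<inter> h -` {x \<in> S. a < g x})"
    using assms(2)
  proof (rule continuous_openin_preimage[where T = S])
    show "h \<in> T \<rightarrow> S" using assms(3) by auto
    show "openin (top_of_set S) {x \<in> S. a < g x}" using assms(1) unfolding lsc_on_iff_openin by blast
  qed
  moreover have "T \<inter> h -` {x \<in> S. a < g x} = {x \<in> T. a < g (h x)}" using assms(3) by auto
  ultimately show "openin (top_of_set T) {x \<in> T. a < g (h x)}" by simp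
qed

lemma lsc_on_continuous: "continuous_on S g \<Longrightarrow> lsc_on S (\<lambda>x. ereal (g x))"
proof -
  assume c: "continuous_on S g"
  have "lsc_on UNIV ereal"
    unfolding lsc_on_iff_openin
  proof
    fix a
    have "open (ereal -` {a<..})" by (intro open_vimage open_greaterThan continuous_intros)
    then show "openin (top_of_set UNIV) {x \<in> UNIV. a < ereal x}" by (simp add: vimage_def)
  qed
  from lsc_on_compose[OF this c] show ?thesis by simp
qed

lemma lsc_on_add:
  assumes "lsc_on S f" "lsc_on S g" "\<And>x. x \<in> S \<Longrightarrow> f x \<noteq> -\<infinity>" "\<And>x. x \<in> S \<Longrightarrow> g x \<noteq> -\<infinity>"
  shows "lsc_on S (\<lambda>x. f x + g x)"
  unfolding lsc_on_iff_openin
proof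
  fix a
  \<comment> \<open>a sum exceeds \<open>a\<close> iff its terms exceed real numbers with sum at least \<open>a\<close>, which
    makes its superlevel set a union of intersections\<close>
  have split: "\<exists>b c. a \<le> ereal b + ereal c \<and> ereal b < y \<and> ereal c < z"
    if lt: "a < y + z" and y: "y \<noteq> -\<infinity>" and z: "z \<noteq> -\<infinity>" for y z :: ereal
  proof (cases "y = \<infinity> \<or> z = \<infinity>")
    case False
    then obtain r s where [simp]: "y = ereal r" "z = ereal s" using y z by (cases y; cases z) auto
    show ?thesis
    proof (cases a)
      case (real q)
      then show ?thesis using lt
        by (intro exI[of _ "r - (r + s - q) / 2"] exI[of _ "s - (r + s - q) / 2"]) (auto simp: field_simps)
    next
      case MInf
      then show ?thesis by (intro exI[of _ "r - 1"] exI[of _ "s - 1"]) simp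
    qed (use lt in auto)
  next
    case True
    have ex: "\<exists>b. ereal b < x" if "x \<noteq> -\<infinity>" for x :: ereal
      using that ereal_dense2[of "-\<infinity>" x] by (metis ereal_infty_less(2) uminus_ereal.simps(1))
    obtain q where q: "a \<le> ereal q" using lt by (cases a) auto
    obtain b c where bc: "ereal b < y" "ereal c < z" using ex y z by blast
    show ?thesis
    proof (cases "y = \<infinity>")
      case True then show ?thesis using q bc
        by (intro exI[of _ "q - c"] exI[of _ c]) auto
    next
      case False
      then have "z = \<infinity>" using \<open>y = \<infinity> \<or> z = \<infinity>\<close> by blast
      then show ?thesis using q bc
        by (intro exI[of _ b] exI[of _ "q - b"]) auto
    qed
  qed
  have "{x \<in> S. a < f x + g x} =
    (\<Union>(b, c)\<in>{(b, c). a \<le> ereal b + ereal c}. {x \<in> S. ereal b < f x} \<inter> {x \<in> S. ereal c < g x})"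
    (is "?L = ?R")
  proof
    show "?L \<subseteq> ?R" using split assms(3,4) by fastforce
    show "?R \<subseteq> ?L" 
    proof clarsimp
      fix x b c assume "a \<le> ereal (b + c)" "ereal b < f x" "ereal c < g x"
      then show "a < f x + g x"
        using le_less_trans[OF _ ereal_add_strict_mono2[of "ereal b" "f x" "ereal c" "g x"]] by simp
    qed
  qed
  moreover have "openin (top_of_set S) ?R"
    using assms(1,2) unfolding lsc_on_iff_openin by (intro openin_Union) auto
  ultimately show "openin (top_of_set S) ?L" by simp
qed

text \<open>
  This is the tube lemma: where \<open>H\<close> exceeds \<open>b\<close> on \<open>{\<xi>} \<times> K\<close>, it does so on a tube around that
  set. A level \<open>b\<close> strictly above \<open>a\<close> is used because the infimum may lose strictness.
\<close>

lemma lsc_on_INF_compact: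
  assumes K: "compact K" and l: "lsc_on (S \<times> K) H"
  shows "lsc_on S (\<lambda>\<xi>. INF k\<in>K. H (\<xi>, k))"
  unfolding lsc_on_iff_openin
proof
  fix a
  have "\<exists>V. openin (top_of_set S) V \<and> \<xi> \<in> V \<and> V \<subseteq> {\<xi> \<in> S. a < (INF k\<in>K. H (\<xi>, k))}"
    if \<xi>: "\<xi> \<in> S" "a < (INF k\<in>K. H (\<xi>, k))" for \<xi>
  proof -
    obtain b where b: "a < b" "b < (INF k\<in>K. H (\<xi>, k))" using dense \<xi>(2) by blast
    obtain W where W: "open W" "{p \<in> S \<times> K. b < H p} = (S \<times> K) \<inter> W"
      using l unfolding lsc_on_iff_openin openin_open by blast
    have "{\<xi>} \<times> K \<subseteq> W"
    proof safe
      fix k assume k: "k \<in> K"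
      then have "b < H (\<xi>, k)" using b(2) by (meson INF_lower less_le_trans)
      then show "(\<xi>, k) \<in> W" using W(2) k \<xi>(1) by blast
    qed
    then obtain V where V: "open V" "\<xi> \<in> V" "V \<times> K \<subseteq> W"
      using Elementary_Topology.tube_lemma[OF K W(1)] by blast
    have "a < (INF k\<in>K. H (\<eta>, k))" if "\<eta> \<in> S \<inter> V" for \<eta>
    proof -
      have "b \<le> H (\<eta>, k)" if "k \<in> K" for k
      proof -
        have "(\<eta>, k) \<in> {p \<in> S \<times> K. b < H p}"
          unfolding W(2) using V(3) that \<open>\<eta> \<in> S \<inter> V\<close> by blast
        then show ?thesis by auto
      qed
      then show ?thesis using b(1) by (meson INF_greatest less_le_trans)
    qed
    then show ?thesis using V \<xi>(1) by (intro exI[of _ "S \<inter> V"]) (auto simp: openin_open)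
  qed
  then show "openin (top_of_set S) {\<xi> \<in> S. a < (INF k\<in>K. H (\<xi>, k))}"
    by (subst openin_subopen) blast
qed

lemma lsc_on_borel_measurable:
  fixes S :: "vec set"
  assumes "lsc_on S g"
  shows "g \<in> borel_measurable (restrict_space borel S)"
proof (rule borel_measurableI_greater)
  fix a
  obtain U where U: "open U" "{x \<in> S. a < g x} = S \<inter> U"
    using assms unfolding lsc_on_iff_openin openin_open by blast
  have "{x \<in> space (restrict_space borel S). a < g x} = S \<inter> U"
    using U(2) by (auto simp: space_restrict_space)
  then show "{x \<in> space (restrict_space borel S). a < g x} \<in> sets (restrict_space borel S)"
    using U(1) by (auto simp: sets_restrict_space)
qed

lemma convex_fun_SUP:
  "(\<And>i. i \<in> I \<Longrightarrow> convex_fun S (f i)) \<Longrightarrow> convex_fun S (\<lambda>x. SUP i\<in>I. f i x)"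
  unfolding convex_fun_def
proof (intro ballI SUP_least)
  fix x y u i
  assume *: "\<And>i. i \<in> I \<Longrightarrow> \<forall>x\<in>S. \<forall>y\<in>S. \<forall>u\<in>{0<..<1}. f i (vcomb u x y) \<le> ereal u * f i x + ereal (1 - u) * f i y"
    and **: "x \<in> S" "y \<in> S" "u \<in> {0<..<1::real}" "i \<in> I"
  have "f i (vcomb u x y) \<le> ereal u * f i x + ereal (1 - u) * f i y" using * ** by blast
  also have "\<dots> \<le> ereal u * (SUP i\<in>I. f i x) + ereal (1 - u) * (SUP i\<in>I. f i y)"
    using ** by (intro add_mono ereal_mult_left_mono SUP_upper) auto
  finally show "f i (vcomb u x y) \<le> \<dots>" .
qed

lemma convex_fun_max: "convex_fun S f \<Longrightarrow> convex_fun S g \<Longrightarrow> convex_fun S (\<lambda>x. max (f x) (g x))"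
  using convex_fun_SUP[of UNIV S "\<lambda>b. if b then f else g"] by (simp add: UNIV_bool sup_max max.commute)

lemma convex_fun_affine: "convex_fun S (\<lambda>x. k + ereal (pairing n l x))"
  unfolding convex_fun_def pairing_vcomb
  by (cases k) (auto simp: algebra_simps)

lemma convex_fun_const: "c \<noteq> -\<infinity> \<Longrightarrow> convex_fun S (\<lambda>x. c)"
  unfolding convex_fun_def by (cases c) (auto simp: algebra_simps)

text \<open>
  The dual vector fixes the slope in \<open>x\<close>, so the infimum is affine in \<open>x\<close> or identically infinite. Both
  the convex hull and the stage value are therefore suprema of affine functions.
\<close>

lemma INF_pairing_eq:
  "(INF z\<in>A. c z + ereal (pairing n l (vdiff x (p z)))) =
   (INF z\<in>A. c z + ereal (- pairing n l (p z))) + ereal (pairing n l x)"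
  unfolding ereal_INF_add_real[symmetric] pairing_vdiff
  by (simp add: add.assoc)

lemma lsc_on_SUP_INF_pairing:
      "lsc_on S (\<lambda>x. SUP l\<in>L. INF z\<in>A. c z + ereal (pairing n l (vdiff x (p z))))"
    and convex_fun_SUP_INF_pairing:
      "convex_fun S (\<lambda>x. SUP l\<in>L. INF z\<in>A. c z + ereal (pairing n l (vdiff x (p z))))"
proof -
  have "lsc_on S (\<lambda>x. k + ereal (pairing n l x))" for k l
  proof (cases k)
    case (real r)
    have "continuous_on S (\<lambda>x. r + pairing n l x)"
      by (intro continuous_intros continuous_on_pairing)
    from lsc_on_continuous[OF this] real show ?thesis by simp
  qed (auto intro: lsc_on_const)
  then show "lsc_on S (\<lambda>x. SUP l\<in>L. INF z\<in>A. c z + ereal (pairing n l (vdiff x (p z))))"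
    unfolding INF_pairing_eq by (intro lsc_on_SUP)
  show "convex_fun S (\<lambda>x. SUP l\<in>L. INF z\<in>A. c z + ereal (pairing n l (vdiff x (p z))))"
    unfolding INF_pairing_eq by (intro convex_fun_SUP convex_fun_affine)
qed

lemma lsc_on_subset: "lsc_on S g \<Longrightarrow> T \<subseteq> S \<Longrightarrow> lsc_on T g"
  using lsc_on_compose[of S g T "\<lambda>x. x"] by (simp add: continuous_on_id image_subset_iff subset_iff)

lemma INF_mono_on: "(\<And>x. x \<in> A \<Longrightarrow> f x \<le> (g x :: ereal)) \<Longrightarrow> (INF x\<in>A. f x) \<le> (INF x\<in>A. g x)"
  by (rule INF_superset_mono) auto

section \<open>Subgradients of convex functions\<close>

lemma pairing_zero: "pairing n (\<lambda>i. 0) x = 0" "pairing n l (\<lambda>i. 0) = 0"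
  by (simp_all add: pairing_def)

text \<open>
  The Hahn-Banach argument, one coordinate at a time: a linear minorant on the first \<open>k\<close> coordinates
  extends to the next one because convexity puts every lower bound for the new slope below every upper
  bound. Induction on the dimension makes this available for a dimension that is a mere number.
\<close>

lemma subgradient_exists:
  assumes conv: "\<And>x y u. x \<in> Rn n \<Longrightarrow> y \<in> Rn n \<Longrightarrow> u \<in> {0<..<1} \<Longrightarrow>
      K (vcomb u x y) \<le> u * K x + (1 - u) * K y"
    and x: "x \<in> Rn n"
  shows "\<exists>l\<in>Rn n. \<forall>w\<in>Rn n. K x + pairing n l (vdiff w x) \<le> K w"
proof -
  \<comment> \<open>moving \<open>x\<close> to the origin turns affine minorants into linear ones\<close>
  define G where "G w = K (\<lambda>i. x i + w i) - K x" for w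
  have G0: "G (\<lambda>i. 0) = 0" by (simp add: G_def)
  have G: "G (vcomb u v w) \<le> u * G v + (1 - u) * G w"
    if "v \<in> Rn n" "w \<in> Rn n" "u \<in> {0<..<1}" for u v w
  proof -
    have "(\<lambda>i. x i + vcomb u v w i) = vcomb u (\<lambda>i. x i + v i) (\<lambda>i. x i + w i)"
      by (auto simp: vcomb_def algebra_simps)
    then show ?thesis
      using conv[OF Rn_add[OF x that(1)] Rn_add[OF x that(2)] that(3)] by (simp add: G_def algebra_simps)
  qed
  have "\<exists>l\<in>Rn k. \<forall>w\<in>Rn k. pairing n l w \<le> G w" if "k \<le> n" for k
    using that
  proof (induction k)
    case 0
    have "w = (\<lambda>i. 0)" if "w \<in> Rn 0" for w using that by (auto simp: Rn_iff)
    then have "\<forall>w\<in>Rn 0. pairing n (\<lambda>i. 0) w \<le> G w" using G0 by (metis (lifting) order_refl pairing_zero)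
    then show ?case using Rn_zero by blast
  next
    case (Suc k)
    then obtain l where l: "l \<in> Rn k" "\<And>w. w \<in> Rn k \<Longrightarrow> pairing n l w \<le> G w" by auto
    have sub: "w \<in> Rn n" if "w \<in> Rn (Suc k)" for w using that Suc.prems by (auto simp: Rn_iff)
    have upd: "v(k := s) \<in> Rn (Suc k)" if "v \<in> Rn k" for v s using that by (auto simp: Rn_iff)
    \<comment> \<open>\<open>A\<close> collects the upper and \<open>B\<close> the lower bounds for the slope in the new coordinate\<close>
    define A where "A v s = (G (v(k := s)) - pairing n l v) / s" for v s
    define B where "B v r = (pairing n l v - G (v(k := - r))) / r" for v r
    have BA: "B v r \<le> A w s" if v: "v \<in> Rn k" and w: "w \<in> Rn k" and r: "r > 0" and s: "s > 0" for v w r s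
    proof -
      \<comment> \<open>the weight for which the new coordinates \<open>-r\<close> and \<open>s\<close> cancel\<close>
      define u where "u = s / (r + s)"
      have u: "u \<in> {0<..<1}" "1 - u = r / (r + s)" using r s by (auto simp: u_def field_simps)
      have rs: "(r + s) * u = s" "(r + s) * (1 - u) = r" using r s by (auto simp: u_def field_simps)
      have vw: "vcomb u v w \<in> Rn k" using v w by (rule Rn_vcomb)
      have "vcomb u (v(k := - r)) (w(k := s)) = (vcomb u v w)(k := 0)"
        unfolding vcomb_def u(2) unfolding u_def using r s by (auto simp: fun_eq_iff field_simps)
      also have "\<dots> = vcomb u v w" using vw by (auto simp: Rn_iff)
      finally have "G (vcomb u v w) \<le> u * G (v(k := - r)) + (1 - u) * G (w(k := s))"
        using G[OF sub[OF upd[OF v]] sub[OF upd[OF w]] u(1), of "- r" s] by simp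
      then have *: "u * pairing n l v + (1 - u) * pairing n l w \<le> u * G (v(k := - r)) + (1 - u) * G (w(k := s))"
        using l(2)[OF vw] by (simp add: pairing_vcomb)
      have "s * pairing n l v + r * pairing n l w \<le> s * G (v(k := - r)) + r * G (w(k := s))"
        using mult_left_mono[OF *, of "r + s"] r s by (simp only: distrib_left mult.assoc[symmetric] rs)
      then show ?thesis unfolding A_def B_def using r s by (simp add: field_simps)
    qed
    \<comment> \<open>any slope between the lower and the upper bounds extends the minorant\<close>
    define c where "c = Sup {B v r | v r. v \<in> Rn k \<and> r > 0}"
    have z: "(\<lambda>i. 0) \<in> Rn k" by (rule Rn_zero)
    have ne: "{B v r | v r. v \<in> Rn k \<and> r > 0} \<noteq> {}" using z zero_less_one by blast
    have bdd: "bdd_above {B v r | v r. v \<in> Rn k \<and> r > 0}"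
      using BA[OF _ z _ zero_less_one] by (intro bdd_aboveI) blast
    have cA: "c \<le> A w s" if "w \<in> Rn k" "s > 0" for w s
      unfolding c_def using BA that ne by (intro cSup_least) auto
    have Bc: "B w s \<le> c" if "w \<in> Rn k" "s > 0" for w s
      unfolding c_def using that bdd by (intro cSup_upper) auto
    have "pairing n (l(k := c)) w \<le> G w" if w: "w \<in> Rn (Suc k)" for w
    proof -
      define v where "v = w(k := 0)"
      have v: "v \<in> Rn k" using w by (auto simp: v_def Rn_iff Suc_le_eq)
      have w_eq: "w = v(k := w k)" by (simp add: v_def)
      have k: "k < n" using Suc.prems by simp
      have "pairing n (l(k := c)) w = (\<Sum>i<n. l i * v i + (if i = k then c * w k else 0))"
        unfolding pairing_def using v l(1) by (intro sum.cong) (auto simp: v_def Rn_iff)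
      then have p: "pairing n (l(k := c)) w = pairing n l v + c * w k"
        using k by (simp add: sum.distrib pairing_def)
      consider "w k = 0" | "w k > 0" | "w k < 0" by linarith
      then show ?thesis
      proof cases
        case 1
        then have "w = v" using w_eq by (simp add: v_def fun_upd_idem)
        then show ?thesis using p 1 l(2)[OF v] by simp
      next
        case 2
        then show ?thesis using cA[OF v 2] p unfolding A_def w_eq[symmetric] by (simp add: field_simps)
      next
        case 3
        then have "- w k > 0" by simp
        from Bc[OF v this] 3 p show ?thesis unfolding B_def by (simp add: w_eq[symmetric] field_simps)
      qed
    qed
    moreover have "l(k := c) \<in> Rn (Suc k)" using l(1) by (rule upd)
    ultimately show ?case by blast
  qed
  then obtain l where l: "l \<in> Rn n" "\<And>w. w \<in> Rn n \<Longrightarrow> pairing n l w \<le> G w" by blast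
  have "K x + pairing n l (vdiff w x) \<le> K w" if "w \<in> Rn n" for w
    using l(2)[OF Rn_vdiff[OF that x]] by (simp add: G_def vdiff_def)
  then show ?thesis using l(1) by blast
qed

section \<open>The closed convex hull of two functions\<close>

lemma conv_hull2_le:
  assumes "x \<in> Rn n"
  shows "conv_hull2 n h1 h2 x \<le> min (h1 x) (h2 x)"
  unfolding conv_hull2_def
proof (rule SUP_least)
  fix l
  have "pairing n l (vdiff x x) = 0" by (simp add: pairing_def vdiff_def)
  then show "(INF z\<in>Rn n. min (h1 z) (h2 z) + ereal (pairing n l (vdiff x z))) \<le> min (h1 x) (h2 x)"
    using INF_lower[OF assms, of "\<lambda>z. min (h1 z) (h2 z) + ereal (pairing n l (vdiff x z))"]
    by (simp del: min_le_iff_disj add: zero_ereal_def[symmetric])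
qed

lemma conv_hull2_lsc: "lsc_on S (conv_hull2 n h1 h2)"
  and conv_hull2_convex: "convex_fun S (conv_hull2 n h1 h2)"
  unfolding conv_hull2_def[abs_def]
  by (fact lsc_on_SUP_INF_pairing[where p = "\<lambda>z. z"], fact convex_fun_SUP_INF_pairing[where p = "\<lambda>z. z"])

text \<open>
  A subgradient of \<open>Q\<close> at \<open>x\<close>, taken as the dual vector, yields an affine function that lies below \<open>Q\<close>, hence
  below both functions, and touches \<open>Q\<close> at \<open>x\<close>.
\<close>

lemma conv_hull2_ge_convex:
  fixes Q :: "vec \<Rightarrow> ereal"
  assumes Q: "convex_fun (Rn n) Q" and fin: "\<And>x. x \<in> Rn n \<Longrightarrow> \<bar>Q x\<bar> \<noteq> \<infinity>"
    and le: "\<And>z. z \<in> Rn n \<Longrightarrow> Q z \<le> h1 z" "\<And>z. z \<in> Rn n \<Longrightarrow> Q z \<le> h2 z"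
    and x: "x \<in> Rn n"
  shows "Q x \<le> conv_hull2 n h1 h2 x"
proof -
  have r: "ereal (real_of_ereal (Q x)) = Q x" if "x \<in> Rn n" for x
    using fin[OF that] by (simp add: ereal_real)
  have "\<exists>l\<in>Rn n. \<forall>w\<in>Rn n. real_of_ereal (Q x) + pairing n l (vdiff w x) \<le> real_of_ereal (Q w)"
  proof (rule subgradient_exists[OF _ x])
    fix x y u assume *: "x \<in> Rn n" "y \<in> Rn n" "u \<in> {0<..<1::real}"
    have "Q (vcomb u x y) \<le> ereal u * Q x + ereal (1 - u) * Q y"
      using Q * unfolding convex_fun_def by blast
    then have "ereal (real_of_ereal (Q (vcomb u x y))) \<le>
        ereal (u * real_of_ereal (Q x) + (1 - u) * real_of_ereal (Q y))"
      using r * r[OF Rn_vcomb[OF *(1,2)]] by (metis plus_ereal.simps(1) times_ereal.simps(1))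
    then show "real_of_ereal (Q (vcomb u x y)) \<le> u * real_of_ereal (Q x) + (1 - u) * real_of_ereal (Q y)"
      by simp
  qed
  then obtain l where l: "l \<in> Rn n"
    "\<And>w. w \<in> Rn n \<Longrightarrow> real_of_ereal (Q x) + pairing n l (vdiff w x) \<le> real_of_ereal (Q w)" by blast
  have "Q x \<le> (INF z\<in>Rn n. min (h1 z) (h2 z) + ereal (pairing n l (vdiff x z)))"
  proof (rule INF_greatest)
    fix z assume z: "z \<in> Rn n"
    have "Q x = ereal (real_of_ereal (Q x))" using r x by simp
    also have "\<dots> \<le> ereal (real_of_ereal (Q z) + pairing n l (vdiff x z))"
      using l(2)[OF z] by (simp add: pairing_vdiff)
    also have "\<dots> = Q z + ereal (pairing n l (vdiff x z))"
      using r[OF z] by (metis plus_ereal.simps(1))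
    also have "\<dots> \<le> min (h1 z) (h2 z) + ereal (pairing n l (vdiff x z))"
      using le z by (intro add_right_mono) simp
    finally show "Q x \<le> \<dots>" .
  qed
  also have "\<dots> \<le> conv_hull2 n h1 h2 x" unfolding conv_hull2_def using l(1) by (rule SUP_upper)
  finally show ?thesis .
qed

text \<open>
  The dual vector zero. The constant may be \<open>\<infinity>\<close>, which covers cost-to-go functions that are infinite and
  have no subgradient.
\<close>

lemma conv_hull2_ge_const:
  assumes "\<And>z. z \<in> Rn n \<Longrightarrow> c \<le> h1 z" "\<And>z. z \<in> Rn n \<Longrightarrow> c \<le> h2 z"
  shows "c \<le> conv_hull2 n h1 h2 x"
proof -
  have "c \<le> (INF z\<in>Rn n. min (h1 z) (h2 z) + ereal (pairing n (\<lambda>i. 0) (vdiff x z)))"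
    using assms by (intro INF_greatest) (simp add: pairing_def zero_ereal_def[symmetric])
  also have "\<dots> \<le> conv_hull2 n h1 h2 x"
    unfolding conv_hull2_def by (rule SUP_upper) (rule Rn_zero)
  finally show ?thesis .
qed

section \<open>Duality and measurability of infimal convolutions\<close>

context Rn_norm
begin

lemma infimal_convolution_lipschitz:
  fixes c :: "vec \<Rightarrow> vec \<Rightarrow> ereal"
  assumes M: "M \<ge> 0" and w: "w \<in> Rn n" and x: "x \<in> Rn n"
  shows "(INF (y, z)\<in>X \<times> Rn n. c y z + ereal (M * N (vdiff w z))) \<le>
    (INF (y, z)\<in>X \<times> Rn n. c y z + ereal (M * N (vdiff x z))) + ereal (M * N (vdiff w x))"
  unfolding ereal_INF_add_real[symmetric]
proof (rule INF_mono_on)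
  fix yz assume "yz \<in> X \<times> Rn n"
  then obtain y z where yz: "yz = (y, z)" "z \<in> Rn n" by auto
  have "M * N (vdiff w z) \<le> M * N (vdiff x z) + M * N (vdiff w x)"
    using mult_left_mono[OF vdiff_triangle[OF w x yz(2)] M] by (simp add: algebra_simps)
  then show "(case yz of (y, z) \<Rightarrow> c y z + ereal (M * N (vdiff w z)))
    \<le> (case yz of (y, z) \<Rightarrow> c y z + ereal (M * N (vdiff x z))) + ereal (M * N (vdiff w x))"
    by (simp add: yz add.assoc add_left_mono)
qed

text \<open>
  Weak duality is the definition of the dual norm. Conversely the infimal convolution on the right is
  finite (unless everything is infinite), convex and \<open>M\<close>-Lipschitz; its subgradient at \<open>x\<close> lies in
  the dual ball by the Lipschitz bound and attains the value on the right.
\<close>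

lemma dual_ball_minimax:
  fixes c :: "vec \<Rightarrow> vec \<Rightarrow> ereal"
  assumes X: "convex_set X" and M: "M \<ge> 0" and x: "x \<in> Rn n"
    and nonneg: "\<And>y z. y \<in> X \<Longrightarrow> z \<in> Rn n \<Longrightarrow> 0 \<le> c y z"
    and conv: "\<And>y y' z z' u. y \<in> X \<Longrightarrow> y' \<in> X \<Longrightarrow> z \<in> Rn n \<Longrightarrow> z' \<in> Rn n \<Longrightarrow> u \<in> {0<..<1} \<Longrightarrow>
      c (vcomb u y y') (vcomb u z z') \<le> ereal u * c y z + ereal (1 - u) * c y' z'"
  shows "(SUP l\<in>{l \<in> Rn n. dual_norm n N l \<le> M}.
            INF (y, z)\<in>X \<times> Rn n. c y z + ereal (pairing n l (vdiff x z))) =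
         (INF (y, z)\<in>X \<times> Rn n. c y z + ereal (M * N (vdiff x z)))"
    (is "?L = ?\<Phi> x")
proof (rule antisym)
  show "?L \<le> ?\<Phi> x"
  proof (intro SUP_least INF_mono_on)
    fix l yz assume "l \<in> {l \<in> Rn n. dual_norm n N l \<le> M}" "yz \<in> X \<times> Rn n"
    then show "(case yz of (y, z) \<Rightarrow> c y z + ereal (pairing n l (vdiff x z)))
        \<le> (case yz of (y, z) \<Rightarrow> c y z + ereal (M * N (vdiff x z)))"
      using dual_norm_le_iff[OF M] Rn_vdiff[OF x] by (auto intro!: add_left_mono)
  qed
next
  show "?\<Phi> x \<le> ?L"
  proof (cases "\<forall>y\<in>X. \<forall>z\<in>Rn n. c y z = \<infinity>")
    case True
    have "dual_norm n N (\<lambda>i. 0) \<le> M"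
      unfolding dual_norm_le_iff[OF M] using M Rn_norm.nonneg[OF Rn_norm_axioms] by (simp add: pairing_zero)
    then have "(INF (y, z)\<in>X \<times> Rn n. c y z + ereal (pairing n (\<lambda>i. 0) (vdiff x z))) \<le> ?L"
      by (intro SUP_upper) (simp add: Rn_zero)
    moreover have "?\<Phi> x \<le> (INF (y, z)\<in>X \<times> Rn n. c y z + ereal (pairing n (\<lambda>i. 0) (vdiff x z)))"
      using True by (intro INF_mono_on) auto
    ultimately show ?thesis by simp
  next
    case False
    then obtain y0 z0 where 0: "y0 \<in> X" "z0 \<in> Rn n" "c y0 z0 \<noteq> \<infinity>" by blast
    have upper: "?\<Phi> w \<le> c y z + ereal (M * N (vdiff w z))" if "y \<in> X" "z \<in> Rn n" for w y z
      using that by (intro INF_lower2[of "(y, z)"]) auto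
    have \<Phi>_nonneg: "0 \<le> ?\<Phi> w" if "w \<in> Rn n" for w
      using nonneg M Rn_norm.nonneg[OF Rn_norm_axioms Rn_vdiff[OF that]] by (intro INF_greatest) auto
    have fin: "\<bar>?\<Phi> w\<bar> \<noteq> \<infinity>" if "w \<in> Rn n" for w
    proof -
      have "?\<Phi> w < \<infinity>"
        using upper[OF 0(1,2), of w] 0(3) by (auto intro: le_less_trans)
      then show ?thesis using \<Phi>_nonneg[OF that] by auto
    qed
    \<comment> \<open>the convolution is finite, so the subgradient theorem for real functions applies\<close>
    define K where "K w = real_of_ereal (?\<Phi> w)" for w
    have K: "?\<Phi> w = ereal (K w)" if "w \<in> Rn n" for w
      using fin[OF that] by (simp add: K_def ereal_real)
    have K_conv: "K (vcomb u v w) \<le> u * K v + (1 - u) * K w"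
      if v: "v \<in> Rn n" and w: "w \<in> Rn n" and u: "u \<in> {0<..<1}" for u v w
    proof (rule field_le_epsilon)
      fix e :: real assume e: "e > 0"
      \<comment> \<open>convexity of an infimum: combine nearly optimal points\<close>
      have near: "\<exists>y z r. y \<in> X \<and> z \<in> Rn n \<and> c y z = ereal r \<and> r + M * N (vdiff w z) \<le> K w + e"
        if w: "w \<in> Rn n" for w
      proof -
        have "?\<Phi> w < ereal (K w + e)" unfolding K[OF w] using e by simp
        then obtain y z where yz: "y \<in> X" "z \<in> Rn n" "c y z + ereal (M * N (vdiff w z)) < ereal (K w + e)"
          unfolding INF_less_iff by auto
        then show ?thesis using nonneg[OF yz(1,2)] by (cases "c y z") (auto intro!: exI)
      qed
      obtain y z r where a: "y \<in> X" "z \<in> Rn n" "c y z = ereal r" "r + M * N (vdiff v z) \<le> K v + e"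
        using near[OF v] by blast
      obtain y' z' r' where b: "y' \<in> X" "z' \<in> Rn n" "c y' z' = ereal r'" "r' + M * N (vdiff w z') \<le> K w + e"
        using near[OF w] by blast
      have X': "vcomb u y y' \<in> X" using X a b u unfolding convex_set_def by auto
      have "vdiff (vcomb u v w) (vcomb u z z') = (\<lambda>i. u * vdiff v z i + (1 - u) * vdiff w z' i)"
        by (auto simp: vdiff_def vcomb_def algebra_simps)
      then have "N (vdiff (vcomb u v w) (vcomb u z z')) \<le> u * N (vdiff v z) + (1 - u) * N (vdiff w z')"
        using triangle[of "\<lambda>i. u * vdiff v z i" "\<lambda>i. (1 - u) * vdiff w z' i"] u
        by (simp add: scale Rn_scale Rn_vdiff v w a b)
      then have N: "M * N (vdiff (vcomb u v w) (vcomb u z z')) \<le> M * (u * N (vdiff v z) + (1 - u) * N (vdiff w z'))"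
        using M by (rule mult_left_mono)
      have "ereal (K (vcomb u v w)) \<le> c (vcomb u y y') (vcomb u z z') + ereal (M * N (vdiff (vcomb u v w) (vcomb u z z')))"
        unfolding K[OF Rn_vcomb[OF v w], symmetric] by (rule upper[OF X' Rn_vcomb[OF a(2) b(2)]])
      also have "\<dots> \<le> ereal (u * r + (1 - u) * r') + ereal (M * (u * N (vdiff v z) + (1 - u) * N (vdiff w z')))"
        using conv[OF a(1) b(1) a(2) b(2) u] N unfolding a(3) b(3) by (intro add_mono) auto
      finally have "K (vcomb u v w) \<le> u * (r + M * N (vdiff v z)) + (1 - u) * (r' + M * N (vdiff w z'))"
        by (simp add: algebra_simps)
      also have "\<dots> \<le> u * (K v + e) + (1 - u) * (K w + e)"
        by (intro add_mono mult_left_mono a(4) b(4)) (use u in auto)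
      finally show "K (vcomb u v w) \<le> u * K v + (1 - u) * K w + e" by (simp add: algebra_simps)
    qed
    have lip: "K w \<le> K x + M * N (vdiff w x)" if w: "w \<in> Rn n" for w
    proof -
      have "ereal (K w) \<le> ereal (K x) + ereal (M * N (vdiff w x))"
        using infimal_convolution_lipschitz[OF M w x, of c X] unfolding K[OF w] K[OF x] .
      then show ?thesis by simp
    qed
    obtain l where l: "l \<in> Rn n" "\<And>w. w \<in> Rn n \<Longrightarrow> K x + pairing n l (vdiff w x) \<le> K w"
      using subgradient_exists[OF K_conv x] by blast
    have "pairing n l v \<le> M * N v" if v: "v \<in> Rn n" for v
    proof -
      have "vdiff (\<lambda>i. x i + v i) x = v" by (simp add: vdiff_def)
      then show ?thesis using l(2)[OF Rn_add[OF x v]] lip[OF Rn_add[OF x v]] by simp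
    qed
    then have "dual_norm n N l \<le> M" unfolding dual_norm_le_iff[OF M] by blast
    then have "(INF (y, z)\<in>X \<times> Rn n. c y z + ereal (pairing n l (vdiff x z))) \<le> ?L"
      using l(1) by (intro SUP_upper) simp
    moreover have "?\<Phi> x \<le> (INF (y, z)\<in>X \<times> Rn n. c y z + ereal (pairing n l (vdiff x z)))"
    proof (rule INF_greatest, clarify)
      fix y z assume yz: "y \<in> X" "z \<in> Rn n"
      have "ereal (K z) \<le> c y z"
        using upper[OF yz, of z] unfolding K[OF yz(2)] by (simp add: vdiff_self zero_ereal_def[symmetric])
      moreover have "K x \<le> K z + pairing n l (vdiff x z)" using l(2)[OF yz(2)] by (simp add: pairing_vdiff)
      ultimately show "?\<Phi> x \<le> c y z + ereal (pairing n l (vdiff x z))"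
        unfolding K[OF x] by (cases "c y z") auto
    qed
    ultimately show ?thesis by simp
  qed
qed

lemma continuous_on_dist: "x \<in> Rn n \<Longrightarrow> continuous_on (Rn n) (\<lambda>z. N (vdiff x z))"
proof -
  assume x: "x \<in> Rn n"
  have "continuous_on (Rn n) (vdiff x)"
    unfolding vdiff_def
    by (intro continuous_on_coordinatewise_then_product continuous_intros)
       (rule continuous_on_subset[OF continuous_on_product_coordinates], simp)
  from continuous_on_compose2[OF continuous_on_norm this] show ?thesis
    using x by (simp add: Rn_vdiff image_subset_iff)
qed

text \<open>
  Over a compact box the infimum is lower semicontinuous in \<open>\<xi>\<close>, and countably many boxes exhaust the
  space.
\<close>

lemma borel_measurable_infimal_convolution:
  fixes c :: "vec \<Rightarrow> vec \<Rightarrow> vec \<Rightarrow> ereal"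
  assumes X: "compact X" and M: "M \<ge> 0" and x: "x \<in> Rn n"
    and lsc: "lsc_on (\<Xi> \<times> (X \<times> Rn n)) (\<lambda>(\<xi>, y, z). c \<xi> y z)"
    and nonneg: "\<And>\<xi> y z. \<xi> \<in> \<Xi> \<Longrightarrow> y \<in> X \<Longrightarrow> z \<in> Rn n \<Longrightarrow> 0 \<le> c \<xi> y z"
  shows "(\<lambda>\<xi>. INF (y, z)\<in>X \<times> Rn n. c \<xi> y z + ereal (M * N (vdiff x z)))
    \<in> borel_measurable (restrict_space borel \<Xi>)"
proof -
  define B where "B m = {z \<in> Rn n. \<forall>i. \<bar>z i\<bar> \<le> real m}" for m
  define H where "H = (\<lambda>(\<xi>, y, z). c \<xi> y z + ereal (M * N (vdiff x z)))"
  have "continuous_on (\<Xi> \<times> (X \<times> Rn n)) (\<lambda>p. N (vdiff x (snd (snd p))))"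
    by (rule continuous_on_compose2[OF continuous_on_dist[OF x]])
       (auto intro!: continuous_on_snd continuous_on_id)
  then have "continuous_on (\<Xi> \<times> (X \<times> Rn n)) (\<lambda>p. M * N (vdiff x (snd (snd p))))"
    by (intro continuous_intros)
  from lsc_on_add[OF lsc lsc_on_continuous[OF this]] nonneg
  have "lsc_on (\<Xi> \<times> (X \<times> Rn n)) H"
    by (force simp: H_def case_prod_unfold)
  then have "lsc_on (\<Xi> \<times> (X \<times> B m)) H" for m
    by (rule lsc_on_subset) (auto simp: B_def)
  then have "lsc_on \<Xi> (\<lambda>\<xi>. INF p\<in>X \<times> B m. H (\<xi>, p))" for m
    unfolding B_def by (intro lsc_on_INF_compact compact_Times X compact_box)
  then have "(\<lambda>\<xi>. INF p\<in>X \<times> B m. H (\<xi>, p)) \<in> borel_measurable (restrict_space borel \<Xi>)" for m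
    by (rule lsc_on_borel_measurable)
  then have "(\<lambda>\<xi>. INF m. INF p\<in>X \<times> B m. H (\<xi>, p)) \<in> borel_measurable (restrict_space borel \<Xi>)"
    by (rule borel_measurable_INF[OF countableI_type])
  moreover have "(INF m. INF p\<in>X \<times> B m. H (\<xi>, p)) = (INF (y, z)\<in>X \<times> Rn n. c \<xi> y z + ereal (M * N (vdiff x z)))" for \<xi>
  proof (rule antisym)
    show "(INF m. INF p\<in>X \<times> B m. H (\<xi>, p)) \<le> (INF (y, z)\<in>X \<times> Rn n. c \<xi> y z + ereal (M * N (vdiff x z)))"
    proof (rule INF_greatest, clarify)
      fix y z assume yz: "y \<in> X" "z \<in> Rn n"
      obtain C where "\<forall>i. \<bar>z i\<bar> \<le> C" using coercive yz(2) by blast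
      then have "z \<in> B (nat \<lceil>C\<rceil>)" using yz(2) real_nat_ceiling_ge[of C] by (auto simp: B_def intro: order_trans)
      then have "(INF p\<in>X \<times> B (nat \<lceil>C\<rceil>). H (\<xi>, p)) \<le> c \<xi> y z + ereal (M * N (vdiff x z))"
        using yz(1) by (intro INF_lower2[of "(y, z)"]) (auto simp: H_def)
      then show "(INF m. INF p\<in>X \<times> B m. H (\<xi>, p)) \<le> c \<xi> y z + ereal (M * N (vdiff x z))"
        by (intro INF_lower2[of "nat \<lceil>C\<rceil>"]) auto
    qed
    show "(INF (y, z)\<in>X \<times> Rn n. c \<xi> y z + ereal (M * N (vdiff x z))) \<le> (INF m. INF p\<in>X \<times> B m. H (\<xi>, p))"
    proof (intro INF_greatest)
      fix m p assume "p \<in> X \<times> B m"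
      then show "(INF (y, z)\<in>X \<times> Rn n. c \<xi> y z + ereal (M * N (vdiff x z))) \<le> H (\<xi>, p)"
        by (intro INF_lower2[of p]) (auto simp: H_def B_def)
    qed
  qed
  ultimately show ?thesis by simp
qed

text \<open>
  The Lipschitz condition is stated with extended reals so that it includes functions that
  are infinite everywhere, and excludes those that are infinite somewhere only.
\<close>

definition regular :: "real \<Rightarrow> (vec \<Rightarrow> ereal) \<Rightarrow> bool"
  where "regular M Q \<longleftrightarrow> (\<forall>x\<in>Rn n. 0 \<le> Q x) \<and> convex_fun (Rn n) Q \<and>
    (\<forall>x\<in>Rn n. \<forall>y\<in>Rn n. Q x \<le> Q y + ereal (M * N (vdiff x y)))"

lemma regular_infinite: "regular M Q \<Longrightarrow> x \<in> Rn n \<Longrightarrow> y \<in> Rn n \<Longrightarrow> Q x = \<infinity> \<Longrightarrow> Q y = \<infinity>"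
  unfolding regular_def by fastforce

lemma regular_lsc:
  assumes Q: "regular M Q"
  shows "lsc_on (Rn n) Q"
proof (cases "\<exists>x\<in>Rn n. Q x = \<infinity>")
  case True
  then have "\<And>x. x \<in> Rn n \<Longrightarrow> \<infinity> = Q x" using regular_infinite[OF Q] by metis
  then show ?thesis by (rule lsc_on_cong[rotated, OF lsc_on_const])
next
  case False
  define K where "K x = real_of_ereal (Q x)" for x
  have K: "ereal (K x) = Q x" if "x \<in> Rn n" for x
  proof -
    have "0 \<le> Q x" "Q x \<noteq> \<infinity>" using that Q False unfolding regular_def by auto
    then show ?thesis by (cases "Q x") (auto simp: K_def)
  qed
  have K1: "K x \<le> K y + M * N (vdiff x y)" if "x \<in> Rn n" "y \<in> Rn n" for x y
  proof -
    have "Q x \<le> Q y + ereal (M * N (vdiff x y))" using Q that unfolding regular_def by blast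
    then show ?thesis unfolding K[OF that(1), symmetric] K[OF that(2), symmetric] by simp
  qed
  have lip: "\<bar>K y - K x\<bar> \<le> M * N (vdiff y x)" if "x \<in> Rn n" "y \<in> Rn n" for x y
    using K1[OF that] K1[OF that(2,1)] unfolding vdiff_commute[OF that] by linarith
  have "continuous_on (Rn n) K"
    unfolding continuous_on_def
  proof
    fix x assume x: "x \<in> Rn n"
    have "((\<lambda>y. M * N (vdiff y x)) \<longlongrightarrow> 0) (at x within Rn n)"
      using tendsto_mult_right_zero[OF tendsto_vdiff[OF x]] .
    then have "((\<lambda>y. K y - K x) \<longlongrightarrow> 0) (at x within Rn n)"
      by (rule Lim_null_comparison[rotated])
         (use lip x in \<open>auto simp: eventually_at_filter intro!: always_eventually\<close>)
    then show "(K \<longlongrightarrow> K x) (at x within Rn n)" by (simp add: Lim_null[symmetric])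
  qed
  from lsc_on_cong[OF K lsc_on_continuous[OF this]] show ?thesis .
qed

end

section \<open>Packing bounds from volume\<close>

text \<open>
  Lebesgue measure on \<open>Rn n\<close>, viewed as a measure on all sequences that is carried by this subspace.
\<close>

definition Rn_lebesgue :: "nat \<Rightarrow> vec measure"
  where "Rn_lebesgue n = distr (Pi\<^sub>M {..<n} (\<lambda>_. lborel)) borel (\<lambda>x i. if i < n then x i else 0)"

lemma measurable_zero_extension:
  fixes n :: nat
  shows "(\<lambda>x i. if i < n then x i else 0) \<in> borel_measurable (Pi\<^sub>M {..<n} (\<lambda>_. lborel :: real measure))"
proof (rule measurable_coordinatewise_then_product)
  fix i show "(\<lambda>x. if i < n then x i else 0) \<in> borel_measurable (Pi\<^sub>M {..<n} (\<lambda>_. lborel :: real measure))"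
    by (cases "i < n") auto
qed

lemma sets_Rn_lebesgue [simp]: "sets (Rn_lebesgue n) = sets borel"
  and space_Rn_lebesgue [simp]: "space (Rn_lebesgue n) = UNIV"
  by (auto simp: Rn_lebesgue_def)

lemma emeasure_Rn_lebesgue_box:
  assumes "r \<ge> 0"
  shows "emeasure (Rn_lebesgue n) {x \<in> Rn n. \<forall>i. \<bar>x i\<bar> \<le> r} = ennreal ((2 * r) ^ n)"
proof -
  interpret product_sigma_finite "\<lambda>_::nat. lborel :: real measure" ..
  let ?B = "{x \<in> Rn n. \<forall>i. \<bar>x i\<bar> \<le> r}"
  have "?B \<in> sets borel" using compact_box by (intro borel_closed compact_imp_closed)
  then have "emeasure (Rn_lebesgue n) ?B =
      emeasure (Pi\<^sub>M {..<n} (\<lambda>_. lborel)) ((\<lambda>x i. if i < n then x i else 0) -` ?B \<inter> space (Pi\<^sub>M {..<n} (\<lambda>_. lborel :: real measure)))"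
    unfolding Rn_lebesgue_def by (intro emeasure_distr measurable_zero_extension)
  also have "(\<lambda>x i. if i < n then x i else 0) -` ?B \<inter> space (Pi\<^sub>M {..<n} (\<lambda>_. lborel :: real measure)) = (\<Pi>\<^sub>E i\<in>{..<n}. {-r..r})"
  proof -
    have "\<bar>a\<bar> \<le> r \<longleftrightarrow> a \<in> {-r..r}" for a by auto
    then show ?thesis using assms by (auto simp: space_PiM PiE_iff Rn_iff)
  qed
  also have "emeasure (Pi\<^sub>M {..<n} (\<lambda>_. lborel)) \<dots> = ennreal ((2 * r) ^ n)"
    using assms by (subst emeasure_PiM) (auto simp: ennreal_power)
  finally show ?thesis .
qed

lemma emeasure_lborel_affine_vimage:
  fixes c r :: real
  assumes r: "r > 0" and A: "A \<in> sets borel"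
  shows "emeasure lborel ((\<lambda>x. (x - c) / r) -` A) = ennreal r * emeasure lborel A"
proof -
  have m: "(\<lambda>x. - (c / r) + 1 / r * x) \<in> borel_measurable lborel" by measurable
  have eq: "(\<lambda>x. - (c / r) + 1 / r * x) = (\<lambda>x. (x - c) / r)" using r by (auto simp: field_simps)
  have "emeasure lborel A = emeasure (density (distr lborel borel (\<lambda>x. - (c / r) + 1 / r * x)) (\<lambda>_. ennreal \<bar>1 / r\<bar>)) A"
    using lborel_real_affine[of "1 / r" "- (c / r)"] r by simp
  also have "\<dots> = ennreal (1 / r) * emeasure lborel ((\<lambda>x. (x - c) / r) -` A)"
    using r A m unfolding eq by (simp add: emeasure_density nn_integral_cmult_indicator emeasure_distr)
  finally have "ennreal r * emeasure lborel A = ennreal r * (ennreal (1 / r) * emeasure lborel ((\<lambda>x. (x - c) / r) -` A))"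
    by simp
  also have "\<dots> = emeasure lborel ((\<lambda>x. (x - c) / r) -` A)"
    using r by (simp add: mult.assoc[symmetric] ennreal_mult[symmetric])
  finally show ?thesis by simp
qed

text \<open>
  A product measure is determined by its values on boxes, where the scaling law is the
  one-dimensional one in each coordinate.
\<close>

lemma emeasure_Rn_lebesgue_affine:
  assumes c: "c \<in> Rn n" and r: "r > 0" and A: "A \<in> sets borel"
  shows "emeasure (Rn_lebesgue n) {x \<in> Rn n. (\<lambda>i. (x i - c i) / r) \<in> A} = ennreal (r ^ n) * emeasure (Rn_lebesgue n) A"
proof -
  interpret product_sigma_finite "\<lambda>_::nat. lborel :: real measure" ..
  define \<mu> where "\<mu> = Pi\<^sub>M {..<n} (\<lambda>_::nat. lborel :: real measure)"
  \<comment> \<open>extension by zero, through which the measure is defined\<close>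
  define e where "e = (\<lambda>x (i::nat). if i < n then x i else 0 :: real)"
  define \<psi> where "\<psi> x = (\<lambda>i\<in>{..<n}. (x i - c i) / r)" for x :: vec
  have e: "e \<in> borel_measurable \<mu>" unfolding e_def \<mu>_def by (rule measurable_zero_extension)
  have \<psi>: "\<psi> \<in> \<mu> \<rightarrow>\<^sub>M \<mu>"
    unfolding \<psi>_def \<mu>_def by (rule measurable_restrict) measurable
  have "scale_measure (ennreal (1 / r ^ n)) (distr \<mu> \<mu> \<psi>) = \<mu>"
    unfolding \<mu>_def
  proof (rule PiM_eqI)
    fix A :: "nat \<Rightarrow> real set" assume A: "\<And>i. i \<in> {..<n} \<Longrightarrow> A i \<in> sets lborel"
    have pre: "\<psi> -` Pi\<^sub>E {..<n} A \<inter> space \<mu> = (\<Pi>\<^sub>E i\<in>{..<n}. (\<lambda>x. (x - c i) / r) -` A i)"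
      by (auto simp: \<psi>_def \<mu>_def space_PiM PiE_iff)
    have sets: "(\<lambda>x. (x - c i) / r) -` A i \<in> sets lborel" if "i \<in> {..<n}" for i
    proof -
      have "(\<lambda>x. (x - c i) / r) \<in> borel \<rightarrow>\<^sub>M borel" by measurable
      from measurable_sets[OF this, of "A i"] show ?thesis using A[OF that] by simp
    qed
    have "emeasure (distr \<mu> \<mu> \<psi>) (Pi\<^sub>E {..<n} A) = emeasure \<mu> (\<Pi>\<^sub>E i\<in>{..<n}. (\<lambda>x. (x - c i) / r) -` A i)"
      unfolding pre[symmetric] using A by (intro emeasure_distr \<psi>) (auto simp: \<mu>_def intro!: sets_PiM_I_finite)
    also have "\<dots> = (\<Prod>i<n. emeasure lborel ((\<lambda>x. (x - c i) / r) -` A i))"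
      unfolding \<mu>_def using sets by (intro emeasure_PiM) auto
    also have "\<dots> = (\<Prod>i<n. ennreal r * emeasure lborel (A i))"
      using A r by (intro prod.cong refl emeasure_lborel_affine_vimage) auto
    also have "\<dots> = ennreal (r ^ n) * (\<Prod>i<n. emeasure lborel (A i))"
      using r by (simp add: prod.distrib ennreal_power)
    finally show "emeasure (scale_measure (ennreal (1 / r ^ n))
        (distr (Pi\<^sub>M {..<n} (\<lambda>_. lborel)) (Pi\<^sub>M {..<n} (\<lambda>_. lborel)) \<psi>)) (Pi\<^sub>E {..<n} A) = (\<Prod>i<n. emeasure lborel (A i))"
      using r by (simp add: \<mu>_def[symmetric] mult.assoc[symmetric] ennreal_mult[symmetric])
  qed auto
  then have scaled: "ennreal (1 / r ^ n) * emeasure (distr \<mu> \<mu> \<psi>) B = emeasure \<mu> B" for B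
    by (metis emeasure_scale_measure)
  have dist: "emeasure (distr \<mu> \<mu> \<psi>) B = ennreal (r ^ n) * emeasure \<mu> B" for B
    unfolding scaled[symmetric] using r by (simp add: mult.assoc[symmetric] ennreal_mult[symmetric])
  let ?S = "{x \<in> Rn n. (\<lambda>i. (x i - c i) / r) \<in> A}"
  have "(\<lambda>x i. (x i - c i) / r) \<in> borel_measurable borel"
    by (intro borel_measurable_continuous_onI continuous_on_coordinatewise_then_product continuous_intros
        continuous_on_product_coordinates) (use r in auto)
  from measurable_sets[OF this A] have S: "?S \<in> sets borel"
    using closed_Rn[of n] by (simp add: vimage_def Collect_conj_eq borel_closed sets.Int)
  have eA: "e -` A \<inter> space \<mu> \<in> sets \<mu>" using e A by (rule measurable_sets)
  have "e (\<psi> x) = (\<lambda>i. (e x i - c i) / r)" for x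
    using c by (auto simp: e_def \<psi>_def Rn_iff)
  then have pre: "e -` ?S \<inter> space \<mu> = \<psi> -` (e -` A \<inter> space \<mu>) \<inter> space \<mu>"
    using measurable_space[OF \<psi>] by (auto simp: Rn_iff) (auto simp: e_def)
  have "emeasure (Rn_lebesgue n) ?S = emeasure \<mu> (e -` ?S \<inter> space \<mu>)"
    unfolding Rn_lebesgue_def using e S by (simp add: emeasure_distr \<mu>_def e_def)
  also have "\<dots> = emeasure (distr \<mu> \<mu> \<psi>) (e -` A \<inter> space \<mu>)"
    unfolding pre using \<psi> eA by (simp add: emeasure_distr)
  also have "\<dots> = ennreal (r ^ n) * emeasure (Rn_lebesgue n) A"
    unfolding dist Rn_lebesgue_def using e A by (simp add: emeasure_distr \<mu>_def e_def)
  finally show ?thesis .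
qed

context Rn_norm
begin

lemma vdiff_zero: "vdiff x (\<lambda>i. 0) = x"
  by (simp add: vdiff_def)

lemma borel_ball: "c \<in> Rn n \<Longrightarrow> {x \<in> Rn n. N (vdiff x c) < r} \<in> sets borel"
proof -
  assume c: "c \<in> Rn n"
  have "continuous_on (Rn n) (\<lambda>x. N (vdiff x c))"
    using continuous_on_dist[OF c] by (rule continuous_on_eq) (simp add: vdiff_commute c)
  then have "openin (top_of_set (Rn n)) (Rn n \<inter> (\<lambda>x. N (vdiff x c)) -` {..<r})"
    by (rule continuous_openin_preimage_gen) simp
  moreover have "Rn n \<inter> (\<lambda>x. N (vdiff x c)) -` {..<r} = {x \<in> Rn n. N (vdiff x c) < r}" by auto
  ultimately obtain U where "open U" "{x \<in> Rn n. N (vdiff x c) < r} = Rn n \<inter> U"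
    unfolding openin_open by auto
  then show ?thesis using closed_Rn by (auto intro: borel_closed borel_open)
qed

lemma volume_ball:
  assumes c: "c \<in> Rn n" and r: "r > 0"
  shows "emeasure (Rn_lebesgue n) {x \<in> Rn n. N (vdiff x c) < r} =
    ennreal (r ^ n) * emeasure (Rn_lebesgue n) {x \<in> Rn n. N x < 1}"
proof -
  have "N (\<lambda>i. (x i - c i) / r) < 1 \<longleftrightarrow> N (vdiff x c) < r" if "x \<in> Rn n" for x
  proof -
    have "N (\<lambda>i. (x i - c i) / r) = N (vdiff x c) / r"
      using scale[OF Rn_vdiff[OF that c], of "1 / r"] r by (simp add: vdiff_def)
    then show ?thesis using r by simp
  qed
  moreover have "(\<lambda>i. (x i - c i) / r) \<in> Rn n" if "x \<in> Rn n" for x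
    using that c by (auto simp: Rn_iff)
  ultimately have "{x \<in> Rn n. N (vdiff x c) < r} = {x \<in> Rn n. (\<lambda>i. (x i - c i) / r) \<in> {x \<in> Rn n. N x < 1}}"
    by auto
  moreover have "{x \<in> Rn n. N x < 1} \<in> sets borel"
    using borel_ball[OF Rn_zero, of 1] by (simp add: vdiff_zero)
  ultimately show ?thesis
    using emeasure_Rn_lebesgue_affine[OF c r, of "{x \<in> Rn n. N x < 1}"] by simp
qed

text \<open>
  The unit ball lies between two boxes, by \<open>coordinate_bound\<close> and \<open>coercive\<close>.
\<close>

lemma
  shows volume_unit_ball_pos: "emeasure (Rn_lebesgue n) {x \<in> Rn n. N x < 1} > 0"
    and volume_unit_ball_finite: "emeasure (Rn_lebesgue n) {x \<in> Rn n. N x < 1} < \<infinity>"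
proof -
  have U: "{x \<in> Rn n. N x < 1} \<in> sets borel"
    using borel_ball[OF Rn_zero, of 1] by (simp add: vdiff_zero)
  have box: "{x \<in> Rn n. \<forall>i. \<bar>x i\<bar> \<le> r} \<in> sets (Rn_lebesgue n)" for r
    using compact_box by (simp add: borel_closed compact_imp_closed)
  obtain C where C: "C \<ge> 0" "\<forall>x\<in>Rn n. N x \<le> C * (\<Sum>i<n. \<bar>x i\<bar>)" using coordinate_bound by blast
  \<comment> \<open>small enough that the box of half-width \<open>\<rho>\<close> fits into the unit ball, also for \<open>C = 0\<close>\<close>
  define \<rho> where "\<rho> = 1 / (C * n + 1)"
  have \<rho>: "\<rho> > 0" using C(1) by (auto simp: \<rho>_def intro!: divide_pos_pos add_nonneg_pos)
  have "C * n < C * n + 1" by simp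
  then have \<rho>1: "C * (n * \<rho>) < 1" using C(1) \<rho> by (simp add: \<rho>_def field_simps add_nonneg_pos)
  have "{x \<in> Rn n. \<forall>i. \<bar>x i\<bar> \<le> \<rho>} \<subseteq> {x \<in> Rn n. N x < 1}"
  proof clarify
    fix x assume x: "x \<in> Rn n" "\<forall>i. \<bar>x i\<bar> \<le> \<rho>"
    have "(\<Sum>i<n. \<bar>x i\<bar>) \<le> n * \<rho>" using sum_mono[of "{..<n}" "\<lambda>i. \<bar>x i\<bar>" "\<lambda>_. \<rho>"] x(2) by simp
    then have "C * (\<Sum>i<n. \<bar>x i\<bar>) \<le> C * (n * \<rho>)" using C(1) by (rule mult_left_mono)
    then show "N x < 1" using C(2) x(1) \<rho>1 by fastforce
  qed
  then have "emeasure (Rn_lebesgue n) {x \<in> Rn n. \<forall>i. \<bar>x i\<bar> \<le> \<rho>} \<le> emeasure (Rn_lebesgue n) {x \<in> Rn n. N x < 1}"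
    using U by (intro emeasure_mono) auto
  moreover have "emeasure (Rn_lebesgue n) {x \<in> Rn n. \<forall>i. \<bar>x i\<bar> \<le> \<rho>} > 0"
    using \<rho> by (subst emeasure_Rn_lebesgue_box) auto
  ultimately show "emeasure (Rn_lebesgue n) {x \<in> Rn n. N x < 1} > 0"
    by (rule less_le_trans[rotated])
  obtain c where c: "c > 0" "\<forall>x\<in>Rn n. \<forall>i. \<bar>x i\<bar> \<le> c * N x" using coercive by blast
  have "{x \<in> Rn n. N x < 1} \<subseteq> {x \<in> Rn n. \<forall>i. \<bar>x i\<bar> \<le> c}"
  proof clarify
    fix x i assume x: "x \<in> Rn n" "N x < 1"
    have "\<bar>x i\<bar> \<le> c * N x" using c(2) x(1) by blast
    also have "\<dots> \<le> c" using x(2) c(1) by simp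
    finally show "\<bar>x i\<bar> \<le> c" .
  qed
  then have "emeasure (Rn_lebesgue n) {x \<in> Rn n. N x < 1} \<le> ennreal ((2 * c) ^ n)"
    using emeasure_mono[OF _ box[of c], of "{x \<in> Rn n. N x < 1}"] emeasure_Rn_lebesgue_box[of c n] c(1) by simp
  then show "emeasure (Rn_lebesgue n) {x \<in> Rn n. N x < 1} < \<infinity>" by (rule le_less_trans) simp
qed

text \<open>
  The open balls of radius \<open>s / 2\<close> around the points are disjoint and lie in the ball of radius
  \<open>(D + s) / 2\<close> around the centre; compare volumes.
\<close>

lemma packing_bound:
  assumes P: "finite P" "P \<subseteq> Rn n" and c: "c \<in> Rn n" and s: "s > 0" and D: "D \<ge> 0"
    and ball: "\<And>p. p \<in> P \<Longrightarrow> N (vdiff p c) \<le> D / 2"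
    and sep: "\<And>p q. p \<in> P \<Longrightarrow> q \<in> P \<Longrightarrow> p \<noteq> q \<Longrightarrow> s \<le> N (vdiff p q)"
  shows "real (card P) \<le> (1 + D / s) ^ n"
proof -
  define U where "U p r = {x \<in> Rn n. N (vdiff x p) < r}" for p r
  define \<beta> where "\<beta> = measure (Rn_lebesgue n) {x \<in> Rn n. N x < 1}"
  have \<beta>: "emeasure (Rn_lebesgue n) {x \<in> Rn n. N x < 1} = ennreal \<beta>"
    unfolding \<beta>_def using volume_unit_ball_finite by (intro emeasure_eq_ennreal_measure) auto
  then have \<beta>_pos: "\<beta> > 0" using volume_unit_ball_pos by (metis ennreal_less_zero_iff)
  have vol: "emeasure (Rn_lebesgue n) (U p r) = ennreal (r ^ n * \<beta>)" if "p \<in> Rn n" "r > 0" for p r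
    unfolding U_def volume_ball[OF that] \<beta> using that \<beta>_pos by (simp add: ennreal_mult)
  have sets: "U p r \<in> sets (Rn_lebesgue n)" if "p \<in> Rn n" for p r
    unfolding U_def using borel_ball[OF that] by simp
  \<comment> \<open>a common point would bring two centres closer than \<open>s\<close>\<close>
  have disj: "disjoint_family_on (\<lambda>p. U p (s / 2)) P"
    unfolding disjoint_family_on_def
  proof (intro ballI impI)
    fix p q assume pq: "p \<in> P" "q \<in> P" "p \<noteq> q"
    have "False" if x: "x \<in> Rn n" "N (vdiff x p) < s / 2" "N (vdiff x q) < s / 2" for x
    proof -
      have R: "p \<in> Rn n" "q \<in> Rn n" using pq P(2) by auto
      have "s \<le> N (vdiff p x) + N (vdiff x q)"
        using sep[OF pq] vdiff_triangle[OF R(1) x(1) R(2)] by simp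
      then show False using x vdiff_commute[OF R(1) x(1)] by simp
    qed
    then show "U p (s / 2) \<inter> U q (s / 2) = {}" unfolding U_def by blast
  qed
  have sub: "(\<Union>p\<in>P. U p (s / 2)) \<subseteq> U c ((D + s) / 2)"
  proof clarify
    fix x p assume p: "p \<in> P" "x \<in> U p (s / 2)"
    then have R: "p \<in> Rn n" "x \<in> Rn n" using P(2) by (auto simp: U_def)
    have "N (vdiff x c) \<le> N (vdiff x p) + N (vdiff p c)" by (rule vdiff_triangle[OF R(2,1) c])
    also have "\<dots> < s / 2 + D / 2" using p ball[OF p(1)] by (simp add: U_def)
    finally show "x \<in> U c ((D + s) / 2)" using R by (simp add: U_def field_simps)
  qed
  have "ennreal (card P * ((s / 2) ^ n * \<beta>)) = (\<Sum>p\<in>P. emeasure (Rn_lebesgue n) (U p (s / 2)))"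
    using P(2) s \<beta>_pos by (simp add: vol subset_iff ennreal_mult ennreal_of_nat_eq_real_of_nat)
  also have "\<dots> = emeasure (Rn_lebesgue n) (\<Union>p\<in>P. U p (s / 2))"
    using P sets disj by (intro sum_emeasure) auto
  also have "\<dots> \<le> emeasure (Rn_lebesgue n) (U c ((D + s) / 2))"
    using sub sets[OF c] by (rule emeasure_mono)
  also have "\<dots> = ennreal (((D + s) / 2) ^ n * \<beta>)" using c D s by (intro vol) auto
  finally have "real (card P) * ((s / 2) ^ n * \<beta>) \<le> ((D + s) / 2) ^ n * \<beta>"
    using D s \<beta>_pos by (subst (asm) ennreal_le_iff) auto
  then have "real (card P) * (s / 2) ^ n \<le> ((D + s) / 2) ^ n" using \<beta>_pos by simp
  also have "\<dots> = (1 + D / s) ^ n * (s / 2) ^ n"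
    unfolding power_mult_distrib[symmetric] using s by (simp add: algebra_simps add_divide_distrib)
  finally show ?thesis using s by simp
qed

end

section \<open>Regularity of the cost-to-go functions\<close>

lemma e2ennreal_lincomb:
  assumes "u \<ge> 0" "v \<ge> 0" "a \<ge> 0" "b \<ge> 0"
  shows "e2ennreal (ereal u * a + ereal v * b) = ennreal u * e2ennreal a + ennreal v * e2ennreal b"
proof -
  have "ereal u * a + ereal v * b = enn2ereal (ennreal u * e2ennreal a + ennreal v * e2ennreal b)"
    using assms by (simp add: plus_ennreal.rep_eq times_ennreal.rep_eq enn2ereal_e2ennreal)
  then show ?thesis by simp
qed

locale multistage =
  fixes pr :: problem
  assumes well_posed: "well_posed pr"
begin

lemma horizon_ge_2: "2 \<le> horizon pr"
  using well_posed unfolding well_posed_def by blast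

lemma Rn_norm_stage: "t \<le> horizon pr \<Longrightarrow> Rn_norm (dimX pr t) (nrm pr t)"
  using well_posed unfolding well_posed_def Rn_norm_def by simp

abbreviation regular_at :: "nat \<Rightarrow> real \<Rightarrow> (vec \<Rightarrow> ereal) \<Rightarrow> bool"
  where "regular_at t \<equiv> Rn_norm.regular (dimX pr t) (nrm pr t)"

lemma Xset: "t \<in> {1..horizon pr} \<Longrightarrow> Xset pr t \<subseteq> Rn (dimX pr t)"
  "t \<in> {1..horizon pr} \<Longrightarrow> Xset pr t \<noteq> {}"
  "t \<in> {1..horizon pr} \<Longrightarrow> compact (Xset pr t)"
  "t \<in> {1..horizon pr} \<Longrightarrow> convex_set (Xset pr t)"
  using well_posed unfolding well_posed_def by simp_all

lemma cost_nonneg: "t \<in> {1..horizon pr} \<Longrightarrow> z \<in> Rn (dimX pr (t - 1)) \<Longrightarrow> y \<in> Rn (dimX pr t) \<Longrightarrow>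
    \<xi> \<in> Xiset pr t \<Longrightarrow> 0 \<le> cost pr t z y \<xi>"
  using well_posed unfolding well_posed_def by simp

lemma cost_lsc: "t \<in> {1..horizon pr} \<Longrightarrow>
    lsc_on (Rn (dimX pr (t - 1)) \<times> Rn (dimX pr t) \<times> Xiset pr t) (\<lambda>(z, y, \<xi>). cost pr t z y \<xi>)"
  using well_posed unfolding well_posed_def by simp

lemma cost_convex: "t \<in> {1..horizon pr} \<Longrightarrow> \<xi> \<in> Xiset pr t \<Longrightarrow>
    z \<in> Rn (dimX pr (t - 1)) \<Longrightarrow> z' \<in> Rn (dimX pr (t - 1)) \<Longrightarrow>
    y \<in> Rn (dimX pr t) \<Longrightarrow> y' \<in> Rn (dimX pr t) \<Longrightarrow> u \<in> {0<..<1} \<Longrightarrow>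
    cost pr t (vcomb u z z') (vcomb u y y') \<xi>
      \<le> ereal u * cost pr t z y \<xi> + ereal (1 - u) * cost pr t z' y' \<xi>"
  using well_posed unfolding well_posed_def by simp

lemma Prob: "t \<in> {2..horizon pr} \<Longrightarrow> Prob pr t \<noteq> {}"
  "t \<in> {2..horizon pr} \<Longrightarrow> p \<in> Prob pr t \<Longrightarrow> prob_space p"
  "t \<in> {2..horizon pr} \<Longrightarrow> p \<in> Prob pr t \<Longrightarrow> sets p = sets (restrict_space borel (Xiset pr t))"
  "t \<in> {2..horizon pr} \<Longrightarrow> 0 < Lip pr t"
  using well_posed unfolding well_posed_def by simp_all

lemma stage_value_eq_infimal_convolution:
  assumes t: "t \<in> {2..horizon pr}" and Q: "regular_at t M Q"
    and x: "x \<in> Rn (dimX pr (t - 1))" and \<xi>: "\<xi> \<in> Xiset pr t"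
  shows "stage_value pr t Q x \<xi> = (INF (y, z)\<in>Xset pr t \<times> Rn (dimX pr (t - 1)).
    cost pr t z y \<xi> + Q y + ereal (Lip pr t * nrm pr (t - 1) (vdiff x z)))"
proof -
  interpret Rn_norm "dimX pr (t - 1)" "nrm pr (t - 1)" using t by (intro Rn_norm_stage) auto
  interpret Y: Rn_norm "dimX pr t" "nrm pr t" using t by (intro Rn_norm_stage) simp
  have t1: "t \<in> {1..horizon pr}" using t by simp
  have Q0: "0 \<le> Q y" if "y \<in> Xset pr t" for y
    using Q Xset(1)[OF t1] that unfolding Y.regular_def by blast
  show ?thesis
    unfolding stage_value_def
  proof (rule dual_ball_minimax)
    show "convex_set (Xset pr t)" "x \<in> Rn (dimX pr (t - 1))" by (fact Xset(4)[OF t1] x)+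
    show "0 \<le> Lip pr t" using Prob(4)[OF t] by simp
    fix y z assume yz: "y \<in> Xset pr t" "z \<in> Rn (dimX pr (t - 1))"
    show "0 \<le> cost pr t z y \<xi> + Q y"
      using cost_nonneg[OF t1 yz(2) _ \<xi>] Q0[OF yz(1)] yz(1) Xset(1)[OF t1] by auto
  next
    fix y y' z z' and u :: real
    assume a: "y \<in> Xset pr t" "y' \<in> Xset pr t" "z \<in> Rn (dimX pr (t - 1))" "z' \<in> Rn (dimX pr (t - 1))" "u \<in> {0<..<1}"
    have y: "y \<in> Rn (dimX pr t)" "y' \<in> Rn (dimX pr t)" using a Xset(1)[OF t1] by auto
    have "Q (vcomb u y y') \<le> ereal u * Q y + ereal (1 - u) * Q y'"
      using Q y a(5) unfolding Y.regular_def convex_fun_def by blast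
    with cost_convex[OF t1 \<xi> a(3,4) y a(5)]
    have "cost pr t (vcomb u z z') (vcomb u y y') \<xi> + Q (vcomb u y y') \<le>
        (ereal u * cost pr t z y \<xi> + ereal (1 - u) * cost pr t z' y' \<xi>) + (ereal u * Q y + ereal (1 - u) * Q y')"
      by (rule add_mono)
    also have "\<dots> = ereal u * (cost pr t z y \<xi> + Q y) + ereal (1 - u) * (cost pr t z' y' \<xi> + Q y')"
      using cost_nonneg[OF t1 a(3) y(1) \<xi>] cost_nonneg[OF t1 a(4) y(2) \<xi>] Q0 a
      by (simp add: ereal_right_distrib add.assoc add.left_commute)
    finally show "cost pr t (vcomb u z z') (vcomb u y y') \<xi> + Q (vcomb u y y') \<le> \<dots>" .
  qed
qed

lemma stage_value_measurable:
  assumes t: "t \<in> {2..horizon pr}" and Q: "regular_at t M Q"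
    and x: "x \<in> Rn (dimX pr (t - 1))"
  shows "stage_value pr t Q x \<in> borel_measurable (restrict_space borel (Xiset pr t))"
proof -
  interpret Rn_norm "dimX pr (t - 1)" "nrm pr (t - 1)" using t by (intro Rn_norm_stage) auto
  interpret Y: Rn_norm "dimX pr t" "nrm pr t" using t by (intro Rn_norm_stage) simp
  have t1: "t \<in> {1..horizon pr}" using t by simp
  let ?D = "Xiset pr t \<times> (Xset pr t \<times> Rn (dimX pr (t - 1)))"
  have Q0: "0 \<le> Q y" if "y \<in> Xset pr t" for y
    using Q Xset(1)[OF t1] that unfolding Y.regular_def by blast
  have "lsc_on ?D (\<lambda>p. (\<lambda>(z, y, \<xi>). cost pr t z y \<xi>) ((\<lambda>(\<xi>, y, z). (z, y, \<xi>)) p))"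
    using cost_lsc[OF t1]
    by (rule lsc_on_compose) (use Xset(1)[OF t1] in \<open>auto simp: case_prod_unfold intro!: continuous_on_Pair continuous_on_fst continuous_on_snd continuous_on_id\<close>)
  moreover have "lsc_on ?D (\<lambda>p. Q (fst (snd p)))"
    using Y.regular_lsc[OF Q]
    by (rule lsc_on_compose) (use Xset(1)[OF t1] in \<open>auto intro!: continuous_on_fst continuous_on_snd continuous_on_id\<close>)
  ultimately have "lsc_on ?D (\<lambda>p. (\<lambda>(z, y, \<xi>). cost pr t z y \<xi>) ((\<lambda>(\<xi>, y, z). (z, y, \<xi>)) p) + Q (fst (snd p)))"
  proof (rule lsc_on_add)
    fix p assume "p \<in> ?D"
    then obtain \<xi> y z where p: "p = (\<xi>, y, z)" "\<xi> \<in> Xiset pr t" "y \<in> Xset pr t" "z \<in> Rn (dimX pr (t - 1))"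
      by (metis mem_Times_iff prod.collapse)
    then have "0 \<le> cost pr t z y \<xi>" "0 \<le> Q y"
      using cost_nonneg[OF t1, of z y \<xi>] Q0[of y] Xset(1)[OF t1] by auto
    then show "(\<lambda>(z, y, \<xi>). cost pr t z y \<xi>) ((\<lambda>(\<xi>, y, z). (z, y, \<xi>)) p) \<noteq> -\<infinity>" "Q (fst (snd p)) \<noteq> -\<infinity>"
      by (auto simp: p(1))
  qed
  then have lsc: "lsc_on ?D (\<lambda>(\<xi>, y, z). cost pr t z y \<xi> + Q y)"
    by (simp add: case_prod_unfold)
  have "(\<lambda>\<xi>. INF (y, z)\<in>Xset pr t \<times> Rn (dimX pr (t - 1)).
      cost pr t z y \<xi> + Q y + ereal (Lip pr t * nrm pr (t - 1) (vdiff x z)))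
    \<in> borel_measurable (restrict_space borel (Xiset pr t))"
  proof (rule borel_measurable_infimal_convolution[OF Xset(3)[OF t1] _ x lsc])
    show "0 \<le> Lip pr t" using Prob(4)[OF t] by simp
    fix \<xi> y z assume "\<xi> \<in> Xiset pr t" "y \<in> Xset pr t" "z \<in> Rn (dimX pr (t - 1))"
    then show "0 \<le> cost pr t z y \<xi> + Q y"
      using cost_nonneg[OF t1] Q0 Xset(1)[OF t1] by (auto intro!: add_nonneg_nonneg)
  qed
  moreover have "stage_value pr t Q x \<xi> = (INF (y, z)\<in>Xset pr t \<times> Rn (dimX pr (t - 1)).
      cost pr t z y \<xi> + Q y + ereal (Lip pr t * nrm pr (t - 1) (vdiff x z)))"
    if "\<xi> \<in> space (restrict_space borel (Xiset pr t))" for \<xi>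
    using stage_value_eq_infimal_convolution[OF t Q x] that unfolding space_restrict_space by blast
  ultimately show ?thesis by (subst measurable_cong)
qed

text \<open>
  Convexity and the Lipschitz bound come from the two descriptions of the stage value: as a
  supremum of affine functions and as an infimal convolution.
\<close>

lemma stage_value_regular:
  assumes t: "t \<in> {2..horizon pr}" and Q: "regular_at t M Q" and \<xi>: "\<xi> \<in> Xiset pr t"
  shows "regular_at (t - 1) (Lip pr t) (\<lambda>x. stage_value pr t Q x \<xi>)"
proof -
  interpret Rn_norm "dimX pr (t - 1)" "nrm pr (t - 1)" using t by (intro Rn_norm_stage) auto
  interpret Y: Rn_norm "dimX pr t" "nrm pr t" using t by (intro Rn_norm_stage) simp
  have t1: "t \<in> {1..horizon pr}" using t by simp
  have M: "0 \<le> Lip pr t" using Prob(4)[OF t] by simp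
  have Q0: "0 \<le> Q y" if "y \<in> Xset pr t" for y
    using Q Xset(1)[OF t1] that unfolding Y.regular_def by blast
  have "0 \<le> stage_value pr t Q x \<xi>" if x: "x \<in> Rn (dimX pr (t - 1))" for x
    unfolding stage_value_eq_infimal_convolution[OF t Q x \<xi>]
  proof (rule INF_greatest, clarify)
    fix y z assume yz: "y \<in> Xset pr t" "z \<in> Rn (dimX pr (t - 1))"
    have "0 \<le> cost pr t z y \<xi>" "0 \<le> Q y"
      using cost_nonneg[OF t1 yz(2) _ \<xi>] Q0[OF yz(1)] Xset(1)[OF t1] yz(1) by auto
    moreover have "0 \<le> Lip pr t * nrm pr (t - 1) (vdiff x z)"
      using M nonneg[OF Rn_vdiff[OF x yz(2)]] by simp
    ultimately show "0 \<le> cost pr t z y \<xi> + Q y + ereal (Lip pr t * nrm pr (t - 1) (vdiff x z))"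
      by simp
  qed
  moreover have "convex_fun S (\<lambda>x. stage_value pr t Q x \<xi>)" for S
    unfolding stage_value_def case_prod_unfold by (rule convex_fun_SUP_INF_pairing)
  moreover have "stage_value pr t Q x \<xi> \<le> stage_value pr t Q y \<xi> + ereal (Lip pr t * nrm pr (t - 1) (vdiff x y))"
    if "x \<in> Rn (dimX pr (t - 1))" "y \<in> Rn (dimX pr (t - 1))" for x y
    unfolding stage_value_eq_infimal_convolution[OF t Q that(1) \<xi>] stage_value_eq_infimal_convolution[OF t Q that(2) \<xi>]
    using infimal_convolution_lipschitz[OF M that, of "\<lambda>y z. cost pr t z y \<xi> + Q y" "Xset pr t"] .
  ultimately show ?thesis unfolding regular_def by simp
qed

text \<open>
  Measurability of the stage value is what makes the integral additive, and hence convexity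
  survive integration.
\<close>

lemma expected_value_regular:
  assumes t: "t \<in> {2..horizon pr}" and Q: "regular_at t M Q"
  shows "regular_at (t - 1) (Lip pr t)
    (\<lambda>x. SUP p\<in>Prob pr t. enn2ereal (\<integral>\<^sup>+ \<xi>. e2ennreal (stage_value pr t Q x \<xi>) \<partial>p))"
proof -
  interpret Rn_norm "dimX pr (t - 1)" "nrm pr (t - 1)" using t by (intro Rn_norm_stage) auto
  let ?n = "dimX pr (t - 1)" and ?M = "Lip pr t" and ?N = "nrm pr (t - 1)"
  define v where "v = (\<lambda>x \<xi>. e2ennreal (stage_value pr t Q x \<xi>))"
  have M: "0 \<le> ?M" using Prob(4)[OF t] by simp
  have space: "space p = Xiset pr t" if "p \<in> Prob pr t" for p
    using sets_eq_imp_space_eq[OF Prob(3)[OF t that]] by (simp add: space_restrict_space)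
  have meas: "v x \<in> borel_measurable p" if "p \<in> Prob pr t" "x \<in> Rn ?n" for p x
  proof -
    have "v x \<in> borel_measurable (restrict_space borel (Xiset pr t))"
      unfolding v_def using stage_value_measurable[OF t Q that(2)] by measurable
    then show ?thesis using measurable_cong_sets[OF Prob(3)[OF t that(1)] refl] by blast
  qed
  have sv: "0 \<le> stage_value pr t Q x \<xi>" "\<And>u y. y \<in> Rn ?n \<Longrightarrow> u \<in> {0<..<1} \<Longrightarrow>
      stage_value pr t Q (vcomb u x y) \<xi> \<le> ereal u * stage_value pr t Q x \<xi> + ereal (1 - u) * stage_value pr t Q y \<xi>"
    "\<And>y. y \<in> Rn ?n \<Longrightarrow> stage_value pr t Q x \<xi> \<le> stage_value pr t Q y \<xi> + ereal (?M * ?N (vdiff x y))"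
    if "\<xi> \<in> Xiset pr t" "x \<in> Rn ?n" for x \<xi>
    using stage_value_regular[OF t Q that(1)] that(2) unfolding regular_def convex_fun_def by blast+
  have "convex_fun (Rn ?n) (\<lambda>x. enn2ereal (\<integral>\<^sup>+ \<xi>. v x \<xi> \<partial>p))" if p: "p \<in> Prob pr t" for p
    unfolding convex_fun_def
  proof (intro ballI)
    fix x y and u :: real assume xy: "x \<in> Rn ?n" "y \<in> Rn ?n" "u \<in> {0<..<1}"
    have "(\<integral>\<^sup>+ \<xi>. v (vcomb u x y) \<xi> \<partial>p) \<le> (\<integral>\<^sup>+ \<xi>. ennreal u * v x \<xi> + ennreal (1 - u) * v y \<xi> \<partial>p)"
    proof (rule nn_integral_mono)
      fix \<xi> assume "\<xi> \<in> space p"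
      then have \<xi>: "\<xi> \<in> Xiset pr t" using space[OF p] by simp
      show "v (vcomb u x y) \<xi> \<le> ennreal u * v x \<xi> + ennreal (1 - u) * v y \<xi>"
        unfolding v_def using e2ennreal_mono[OF sv(2)[OF \<xi> xy]] sv(1)[OF \<xi>] xy
        by (simp add: e2ennreal_lincomb)
    qed
    also have "\<dots> = ennreal u * (\<integral>\<^sup>+ \<xi>. v x \<xi> \<partial>p) + ennreal (1 - u) * (\<integral>\<^sup>+ \<xi>. v y \<xi> \<partial>p)"
      using meas[OF p] xy by (simp add: nn_integral_add nn_integral_cmult)
    finally have "enn2ereal (\<integral>\<^sup>+ \<xi>. v (vcomb u x y) \<xi> \<partial>p) \<le>
        enn2ereal (ennreal u * (\<integral>\<^sup>+ \<xi>. v x \<xi> \<partial>p) + ennreal (1 - u) * (\<integral>\<^sup>+ \<xi>. v y \<xi> \<partial>p))"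
      by (simp add: less_eq_ennreal.rep_eq)
    then show "enn2ereal (\<integral>\<^sup>+ \<xi>. v (vcomb u x y) \<xi> \<partial>p) \<le>
        ereal u * enn2ereal (\<integral>\<^sup>+ \<xi>. v x \<xi> \<partial>p) + ereal (1 - u) * enn2ereal (\<integral>\<^sup>+ \<xi>. v y \<xi> \<partial>p)"
      using xy(3) by (simp add: plus_ennreal.rep_eq times_ennreal.rep_eq)
  qed
  then have "convex_fun (Rn ?n) (\<lambda>x. SUP p\<in>Prob pr t. enn2ereal (\<integral>\<^sup>+ \<xi>. v x \<xi> \<partial>p))"
    by (rule convex_fun_SUP)
  moreover have "(SUP p\<in>Prob pr t. enn2ereal (\<integral>\<^sup>+ \<xi>. v x \<xi> \<partial>p)) \<le>
      (SUP p\<in>Prob pr t. enn2ereal (\<integral>\<^sup>+ \<xi>. v y \<xi> \<partial>p)) + ereal (?M * ?N (vdiff x y))"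
    if xy: "x \<in> Rn ?n" "y \<in> Rn ?n" for x y
  proof (rule SUP_least)
    fix p assume p: "p \<in> Prob pr t"
    interpret p: prob_space p using Prob(2)[OF t p] .
    have MN: "0 \<le> ?M * ?N (vdiff x y)" using M nonneg[OF Rn_vdiff[OF xy]] by simp
    have "(\<integral>\<^sup>+ \<xi>. v x \<xi> \<partial>p) \<le> (\<integral>\<^sup>+ \<xi>. v y \<xi> + ennreal (?M * ?N (vdiff x y)) \<partial>p)"
    proof (rule nn_integral_mono)
      fix \<xi> assume "\<xi> \<in> space p"
      then have \<xi>: "\<xi> \<in> Xiset pr t" using space[OF p] by simp
      show "v x \<xi> \<le> v y \<xi> + ennreal (?M * ?N (vdiff x y))"
        unfolding v_def using e2ennreal_mono[OF sv(3)[OF \<xi> xy]] sv(1)[OF \<xi> xy(2)] MN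
          e2ennreal_lincomb[of 1 1 "stage_value pr t Q y \<xi>" "ereal (?M * ?N (vdiff x y))"]
        by (simp add: one_ereal_def[symmetric])
    qed
    also have "\<dots> = (\<integral>\<^sup>+ \<xi>. v y \<xi> \<partial>p) + ennreal (?M * ?N (vdiff x y))"
      using meas[OF p xy(2)] by (simp add: nn_integral_add p.emeasure_space_1)
    finally have "enn2ereal (\<integral>\<^sup>+ \<xi>. v x \<xi> \<partial>p) \<le> enn2ereal (\<integral>\<^sup>+ \<xi>. v y \<xi> \<partial>p) + ereal (?M * ?N (vdiff x y))"
      using MN by (simp add: less_eq_ennreal.rep_eq plus_ennreal.rep_eq)
    also have "\<dots> \<le> (SUP p\<in>Prob pr t. enn2ereal (\<integral>\<^sup>+ \<xi>. v y \<xi> \<partial>p)) + ereal (?M * ?N (vdiff x y))"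
      using p by (intro add_right_mono SUP_upper)
    finally show "enn2ereal (\<integral>\<^sup>+ \<xi>. v x \<xi> \<partial>p) \<le> \<dots>" .
  qed
  moreover have "0 \<le> (SUP p\<in>Prob pr t. enn2ereal (\<integral>\<^sup>+ \<xi>. v x \<xi> \<partial>p))" for x
    using Prob(1)[OF t] by (auto intro: SUP_upper2)
  ultimately show ?thesis unfolding regular_def v_def by blast
qed

lemma cost_to_go_horizon: "cost_to_go pr (horizon pr) = (\<lambda>x. 0)"
  by (simp add: cost_to_go.simps)

lemma cost_to_go_regular:
  assumes "t \<in> {1..<horizon pr}"
  shows "regular_at t (Lip pr (Suc t)) (cost_to_go pr t)"
proof -
  have down: "regular_at t (Lip pr (Suc t)) (cost_to_go pr t)"
    if t: "t \<in> {1..<horizon pr}" and Q: "regular_at (Suc t) M (cost_to_go pr (Suc t))" for t M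
    using expected_value_regular[of "Suc t" M "cost_to_go pr (Suc t)"] t Q
    by (subst cost_to_go.simps) simp
  have top: "regular_at (horizon pr) 0 (cost_to_go pr (horizon pr))"
  proof -
    interpret Rn_norm "dimX pr (horizon pr)" "nrm pr (horizon pr)" by (rule Rn_norm_stage) simp
    show ?thesis unfolding regular_def cost_to_go_horizon
      by (auto simp: convex_fun_const zero_ereal_def[symmetric])
  qed
  have "\<exists>M. regular_at t M (cost_to_go pr t)" if "t \<le> horizon pr" "1 \<le> t" for t
    using that
  proof (induction t rule: inc_induct)
    case base then show ?case using top by blast
  next
    case (step t) then show ?case using down[of t] by auto
  qed
  from this[of "Suc t"] show ?thesis using assms down[of t] by auto
qed

end

section \<open>Bounds maintained by the algorithm\<close>

locale cddp_run = multistage +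
  fixes O1 :: initial_oracle and Orc :: stage_oracle
  assumes initial_oracle: "is_initial_oracle pr O1"
    and stage_oracle: "t \<in> {2..horizon pr} \<Longrightarrow> is_stage_oracle pr Orc t"
begin

text \<open>
  The upper bound is required on the whole space and not only on \<open>Xset\<close>, because the value of a convex hull
  at one point depends on the function everywhere. The lower bound is known on \<open>Xset\<close> only, since cuts
  are valid only there.
\<close>

definition sandwich :: "nat \<Rightarrow> (vec \<Rightarrow> ereal) \<Rightarrow> (vec \<Rightarrow> ereal) \<Rightarrow> bool"
  where "sandwich t lo up \<longleftrightarrow>
    (\<forall>g\<in>{lo, up}. lsc_on (Rn (dimX pr t)) g \<and> convex_fun (Rn (dimX pr t)) g) \<and>
    (\<forall>x\<in>Rn (dimX pr t). 0 \<le> lo x \<and> lo x < \<infinity> \<and> cost_to_go pr t x \<le> up x) \<and>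
    (\<forall>x\<in>Xset pr t. lo x \<le> cost_to_go pr t x)"

lemma cost_to_go_nonneg:
  assumes t: "t \<in> {1..horizon pr}" and x: "x \<in> Rn (dimX pr t)"
  shows "0 \<le> cost_to_go pr t x"
proof (cases "t = horizon pr")
  case True then show ?thesis by (simp add: cost_to_go_horizon)
next
  case False
  then have t': "t \<in> {1..<horizon pr}" using t by auto
  interpret Rn_norm "dimX pr t" "nrm pr t" using t by (intro Rn_norm_stage) auto
  show ?thesis using cost_to_go_regular[OF t'] x unfolding regular_def by blast
qed

lemma sandwich_valid_bounds:
  assumes t: "t \<in> {1..horizon pr}" and s: "sandwich t lo up"
  shows "valid_bounds pr t lo up"
proof -
  have "lo x \<noteq> -\<infinity>" "up x \<noteq> -\<infinity>" if x: "x \<in> Rn (dimX pr t)" for x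
  proof -
    have "0 \<le> lo x" "0 \<le> up x"
      using s x cost_to_go_nonneg[OF t x] unfolding sandwich_def by (auto intro: order_trans)
    then show "lo x \<noteq> -\<infinity>" "up x \<noteq> -\<infinity>" by auto
  qed
  then show ?thesis using s Xset(1)[OF t] unfolding sandwich_def valid_bounds_def by blast
qed

lemma sandwich_initial:
  assumes t: "t \<in> {1..horizon pr}"
  shows "sandwich t (\<lambda>x. 0) (\<lambda>x. if t < horizon pr then \<infinity> else 0)"
proof (cases "t = horizon pr")
  case True
  show ?thesis unfolding True sandwich_def cost_to_go_horizon by (simp add: lsc_on_const convex_fun_const)
next
  case False
  then have "t < horizon pr" using t by auto
  moreover have "0 \<le> cost_to_go pr t x" if "x \<in> Xset pr t" for x
    using cost_to_go_nonneg[OF t] Xset(1)[OF t] that by blast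
  ultimately show ?thesis unfolding sandwich_def by (simp add: lsc_on_const convex_fun_const)
qed

text \<open>
  The cone over \<open>v\<close> majorizes the cost-to-go function since the latter is Lipschitz with the slope of
  the cone.
\<close>

lemma sandwich_update:
  assumes t: "t \<in> {1..<horizon pr}" and s: "sandwich t lo up" and x: "x \<in> Xset pr t"
    and V: "affine_fun (dimX pr t) V" "\<And>w. w \<in> Xset pr t \<Longrightarrow> ereal (V w) \<le> cost_to_go pr t w"
    and v: "cost_to_go pr t x \<le> v"
  shows "sandwich t (\<lambda>w. max (lo w) (ereal (V w)))
    (conv_hull2 (dimX pr t) up (\<lambda>w. v + ereal (Lip pr (Suc t) * nrm pr t (vdiff w x))))"
    (is "sandwich t ?lo ?up")
proof -
  have t1: "t \<in> {1..horizon pr}" using t by auto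
  interpret Rn_norm "dimX pr t" "nrm pr t" using t by (intro Rn_norm_stage) auto
  let ?n = "dimX pr t"
  have xR: "x \<in> Rn ?n" using x Xset(1)[OF t1] by blast
  have Q: "regular (Lip pr (Suc t)) (cost_to_go pr t)" by (rule cost_to_go_regular[OF t])
  obtain a b where V': "\<And>w. w \<in> Rn ?n \<Longrightarrow> V w = b + pairing ?n a w"
    using V(1) unfolding affine_fun_def by (metis add.commute)
  have "lsc_on (Rn ?n) (\<lambda>w. ereal (V w))"
    using lsc_on_continuous[of "Rn ?n" "\<lambda>w. b + pairing ?n a w"]
    by (rule lsc_on_cong[rotated]) (auto simp: V' intro!: continuous_intros continuous_on_pairing)
  moreover have "convex_fun (Rn ?n) (\<lambda>w. ereal (V w))"
    using convex_fun_affine[of "Rn ?n" "ereal b" ?n a] unfolding convex_fun_def by (simp add: V' Rn_vcomb)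
  ultimately have lo: "lsc_on (Rn ?n) ?lo" "convex_fun (Rn ?n) ?lo"
    using s unfolding sandwich_def by (auto intro: lsc_on_max convex_fun_max)
  have h1: "cost_to_go pr t w \<le> up w" if "w \<in> Rn ?n" for w
    using s that unfolding sandwich_def by blast
  have h2: "cost_to_go pr t w \<le> v + ereal (Lip pr (Suc t) * nrm pr t (vdiff w x))" if "w \<in> Rn ?n" for w
  proof -
    have "cost_to_go pr t w \<le> cost_to_go pr t x + ereal (Lip pr (Suc t) * nrm pr t (vdiff w x))"
      using Q that xR unfolding regular_def by blast
    also have "\<dots> \<le> v + ereal (Lip pr (Suc t) * nrm pr t (vdiff w x))" using v by (rule add_right_mono)
    finally show ?thesis .
  qed
  have up: "cost_to_go pr t w \<le> ?up w" if w: "w \<in> Rn ?n" for w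
  proof (cases "cost_to_go pr t w = \<infinity>")
    case True
    then have inf: "cost_to_go pr t z = \<infinity>" if "z \<in> Rn ?n" for z
      using regular_infinite[OF Q w that] by blast
    show ?thesis unfolding True by (rule conv_hull2_ge_const) (use inf h1 h2 in \<open>force+\<close>)
  next
    case False
    then have "\<bar>cost_to_go pr t z\<bar> \<noteq> \<infinity>" if "z \<in> Rn ?n" for z
      using regular_infinite[OF Q that w] cost_to_go_nonneg[OF t1 that] by force
    then show ?thesis using Q h1 h2 w unfolding regular_def by (intro conv_hull2_ge_convex) auto
  qed
  have "0 \<le> ?lo w" if "w \<in> Rn ?n" for w
    using s that unfolding sandwich_def by (simp add: le_max_iff_disj)
  moreover have "?lo w < \<infinity>" if "w \<in> Rn ?n" for w
    using s that unfolding sandwich_def by (simp add: max_def)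
  moreover have "?lo w \<le> cost_to_go pr t w" if "w \<in> Xset pr t" for w
    using s V(2)[OF that] that unfolding sandwich_def by simp
  ultimately show ?thesis
    using lo up unfolding sandwich_def by (simp add: conv_hull2_lsc conv_hull2_convex)
qed

definition gap :: "state \<Rightarrow> nat \<Rightarrow> vec \<Rightarrow> ereal"
  where "gap s t x = over s t x - under s t x"

definition sandwiched :: "state \<Rightarrow> bool"
  where "sandwiched s \<longleftrightarrow> (\<forall>t\<in>{1..horizon pr}. sandwich t (under s t) (over s t)) \<and>
    under s (horizon pr) = (\<lambda>x. 0) \<and> over s (horizon pr) = (\<lambda>x. 0)"

text \<open>
  Here \<open>c\<close> is the cost of the current first-stage point. \<open>UB\<close> is the best value found so far, so it can
  only be smaller than the one of the current point.
\<close>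

definition invariant :: "state \<Rightarrow> bool"
  where "invariant s \<longleftrightarrow> sandwiched s \<and> point s 1 \<in> Xset pr 1 \<and>
    (\<exists>c::real. LB s = ereal c + under s 1 (point s 1) \<and> UB s \<le> ereal c + over s 1 (point s 1))"

lemma invariant_gap:
  assumes "invariant s"
  shows "UB s - LB s \<le> gap s 1 (point s 1)"
proof -
  obtain c where c: "LB s = ereal c + under s 1 (point s 1)" "UB s \<le> ereal c + over s 1 (point s 1)"
    using assms unfolding invariant_def by blast
  have "0 \<le> under s 1 (point s 1)" "under s 1 (point s 1) < \<infinity>"
    using assms horizon_ge_2 Xset(1)[of 1] unfolding invariant_def sandwiched_def sandwich_def by auto
  then show ?thesis using c unfolding gap_def
    by (cases "under s 1 (point s 1)"; cases "over s 1 (point s 1)"; cases "UB s") auto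
qed

text \<open>
  The oracle returns a minimizer, and some point has finite cost; so the subtraction of lower from upper
  bound never meets \<open>\<infinity> - \<infinity>\<close>.
\<close>

lemma initial_oracle_finite_cost:
  assumes "sandwich 1 lo up" "O1 lo up = (x, \<gamma>)"
  shows "x \<in> Xset pr 1 \<and> (\<exists>c. cost pr 1 (xinit pr) x (xiinit pr) = ereal c)"
proof -
  let ?f = "\<lambda>x. cost pr 1 (xinit pr) x (xiinit pr)"
  have one: "1 \<in> {1..horizon pr}" using horizon_ge_2 by simp
  have x: "x \<in> Xset pr 1" "\<And>y. y \<in> Xset pr 1 \<Longrightarrow> ?f x + lo x \<le> ?f y + lo y"
    using initial_oracle[unfolded is_initial_oracle_def, rule_format,
        OF conjI[OF sandwich_valid_bounds[OF one assms(1)] assms(2)]] by simp_all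
  have "\<exists>y\<in>Xset pr 1. ?f y < \<infinity>" using well_posed unfolding well_posed_def by simp
  then obtain y where y: "y \<in> Xset pr 1" "?f y < \<infinity>" by blast
  have lo: "0 \<le> lo x" "lo y < \<infinity>" using assms(1) x(1) y(1) Xset(1)[OF one] unfolding sandwich_def by auto
  have "xinit pr \<in> Rn (dimX pr (1 - 1))" "xiinit pr \<in> Xiset pr 1"
    using well_posed unfolding well_posed_def by simp_all
  then have "0 \<le> ?f x" using cost_nonneg[OF one] x(1) Xset(1)[OF one] by blast
  moreover have "?f x \<noteq> \<infinity>" using x(2)[OF y(1)] y(2) lo by auto
  ultimately show ?thesis using x(1) by (cases "?f x") auto
qed

lemma invariant_init: "invariant (cddp_init pr O1)"
proof -
  have "1 < horizon pr" using horizon_ge_2 by simp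
  then have s: "sandwich 1 (\<lambda>x. 0) (\<lambda>x. \<infinity>)" using sandwich_initial[of 1] by simp
  obtain x \<gamma> where O: "O1 (\<lambda>x. 0) (\<lambda>x. \<infinity>) = (x, \<gamma>)" by fastforce
  then obtain c where x: "x \<in> Xset pr 1" and c: "cost pr 1 (xinit pr) x (xiinit pr) = ereal c"
    using initial_oracle_finite_cost[OF s O] by blast
  define s0 where "s0 = cddp_init pr O1"
  have s0: "under s0 = (\<lambda>t x. 0)" "over s0 = (\<lambda>t x. if t < horizon pr then \<infinity> else 0)"
      "point s0 1 = x" "LB s0 = ereal c" "UB s0 = \<infinity>"
    using O c \<open>1 < horizon pr\<close> unfolding s0_def cddp_init_def by (simp_all add: Let_def)
  have "sandwiched s0" unfolding sandwiched_def s0 using sandwich_initial by simp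
  moreover have "LB s0 = ereal c + under s0 1 (point s0 1)" "UB s0 \<le> ereal c + over s0 1 (point s0 1)"
    unfolding s0 using \<open>1 < horizon pr\<close> by simp_all
  ultimately show ?thesis unfolding invariant_def s0_def[symmetric] using x s0(3) by blast
qed

lemma initial_step:
  assumes "sandwiched s"
  shows "invariant (initial_step pr O1 s)" "under (initial_step pr O1 s) = under s"
    "over (initial_step pr O1 s) = over s" "evals (initial_step pr O1 s) = Suc (evals s)"
proof -
  have s: "sandwich 1 (under s 1) (over s 1)" using assms horizon_ge_2 unfolding sandwiched_def by simp
  obtain x \<gamma> where O: "O1 (under s 1) (over s 1) = (x, \<gamma>)" by fastforce
  then obtain c where x: "x \<in> Xset pr 1" and c: "cost pr 1 (xinit pr) x (xiinit pr) = ereal c"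
    using initial_oracle_finite_cost[OF s O] by blast
  define s' where "s' = initial_step pr O1 s"
  have s': "under s' = under s" "over s' = over s" "evals s' = Suc (evals s)" "point s' 1 = x"
      "LB s' = ereal c + under s 1 x" "UB s' \<le> ereal c + over s 1 x"
    using O c unfolding s'_def initial_step_def by (simp_all add: Let_def not_less)
  have "sandwiched s'" using assms unfolding sandwiched_def s' .
  then show "invariant (initial_step pr O1 s)"
    unfolding invariant_def s'_def[symmetric] s' using x s'(5,6) by blast
  show "under (initial_step pr O1 s) = under s" "over (initial_step pr O1 s) = over s"
      "evals (initial_step pr O1 s) = Suc (evals s)"
    using s' unfolding s'_def by blast+
qed

text \<open>
  The gap is that of the state \<open>s\<close> before the forward pass, because the pass leaves the approximations
  alone; \<open>f\<close> is the state that records the answers.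
\<close>

definition oracle_answer :: "state \<Rightarrow> state \<Rightarrow> nat \<Rightarrow> bool"
  where "oracle_answer s f t \<longleftrightarrow>
    affine_fun (dimX pr t) (cut f t) \<and>
    lipschitz_fun (dimX pr t) (nrm pr t) (Lip pr (Suc t)) (cut f t) \<and>
    (\<forall>w\<in>Xset pr t. ereal (cut f t w) \<le> cost_to_go pr t w) \<and>
    cost_to_go pr t (point f t) \<le> val f t \<and> val f t \<noteq> -\<infinity> \<and>
    val f t - ereal (cut f t (point f t)) \<le> gap s (Suc t) (point f (Suc t))"

lemma forward_pass:
  assumes s: "invariant s" and k: "k \<in> {1..horizon pr}"
  defines "f \<equiv> fold (forward_step Orc) [2..<Suc k] s"
  shows "under f = under s \<and> over f = over s \<and> evals f = evals s + (k - 1) \<and> point f 1 = point s 1 \<and>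
    (\<forall>t\<in>{1..k}. point f t \<in> Xset pr t) \<and> (\<forall>t\<in>{1..<k}. oracle_answer s f t)"
  using k unfolding f_def
proof (induction k)
  case (Suc k)
  show ?case
  proof (cases "k = 0")
    case True then show ?thesis using s by (simp add: invariant_def)
  next
    case False
    define f where "f = fold (forward_step Orc) [2..<Suc k] s"
    have IH: "under f = under s" "over f = over s" "evals f = evals s + (k - 1)" "point f 1 = point s 1"
      "\<And>t. t \<in> {1..k} \<Longrightarrow> point f t \<in> Xset pr t" "\<And>t. t \<in> {1..<k} \<Longrightarrow> oracle_answer s f t"
      using Suc.IH Suc.prems False unfolding f_def by auto
    have eq: "fold (forward_step Orc) [2..<Suc (Suc k)] s = forward_step Orc (Suc k) f"
      using False by (simp add: f_def)
    obtain V v x \<gamma> where O: "Orc (Suc k) (point f k) (under s (Suc k)) (over s (Suc k)) = (V, v, x, \<gamma>)"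
      by (metis prod_cases4)
    have k: "Suc k \<in> {2..horizon pr}" "Suc k \<in> {1..horizon pr}" using Suc.prems False by auto
    have "valid_bounds pr (Suc k) (under s (Suc k)) (over s (Suc k))"
      using s k(2) unfolding invariant_def sandwiched_def by (intro sandwich_valid_bounds) auto
    moreover have "point f k \<in> Xset pr (Suc k - 1)" using IH(5)[of k] False by simp
    ultimately have o: "x \<in> Xset pr (Suc k)" "affine_fun (dimX pr k) V"
       "lipschitz_fun (dimX pr k) (nrm pr k) (Lip pr (Suc k)) V" "v \<noteq> -\<infinity>"
       "\<forall>w\<in>Xset pr k. ereal (V w) \<le> cost_to_go pr k w"
       "cost_to_go pr k (point f k) \<le> v" "v - ereal (V (point f k)) \<le> over s (Suc k) x - under s (Suc k) x"
      using stage_oracle[OF k(1), unfolded is_stage_oracle_def, rule_format, of "point f k" "under s (Suc k)" "over s (Suc k)" V v x \<gamma>] O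
      by auto
    define g where "g = forward_step Orc (Suc k) f"
    have g: "g = f\<lparr> point := (point f)(Suc k := x), cut := (cut f)(k := V), val := (val f)(k := v),
            evals := Suc (evals f) \<rparr>"
      unfolding g_def forward_step_def using O IH(1,2) by simp
    have "oracle_answer s g t" if "t \<in> {1..<Suc k}" for t
    proof (cases "t = k")
      case True then show ?thesis using o unfolding oracle_answer_def by (simp add: g gap_def)
    next
      case False
      then have "oracle_answer s f t" using IH(6) that by simp
      then show ?thesis using False that unfolding oracle_answer_def by (simp add: g)
    qed
    moreover have "point g t \<in> Xset pr t" if "t \<in> {1..Suc k}" for t
      using IH(5)[of t] o(1) that by (cases "t = Suc k") (auto simp: g)
    ultimately show ?thesis
      unfolding eq g_def[symmetric] using IH(1-4) False by (auto simp: g)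
  qed
qed simp

text \<open>
  Each step changes and reads the data of one stage only, so the steps do not interact.
\<close>

lemma backward_pass:
  "fold (backward_step pr) (rev [2..<Suc k]) s =
    s \<lparr> under := (\<lambda>t. if t \<in> {1..<k} then (\<lambda>x. max (under s t x) (ereal (cut s t x))) else under s t),
        over := (\<lambda>t. if t \<in> {1..<k} then conv_hull2 (dimX pr t) (over s t)
          (\<lambda>x. val s t + ereal (Lip pr (Suc t) * nrm pr t (vdiff x (point s t)))) else over s t) \<rparr>"
proof (induction k arbitrary: s)
  case (Suc k)
  show ?case
  proof (cases "k = 0")
    case True then show ?thesis by simp
  next
    case False
    then have "rev [2..<Suc (Suc k)] = Suc k # rev [2..<Suc k]" by simp
    then have "fold (backward_step pr) (rev [2..<Suc (Suc k)]) s =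
        fold (backward_step pr) (rev [2..<Suc k]) (backward_step pr (Suc k) s)" by simp
    also have "\<dots> = s \<lparr> under := (\<lambda>t. if t \<in> {1..<Suc k} then (\<lambda>x. max (under s t x) (ereal (cut s t x))) else under s t),
        over := (\<lambda>t. if t \<in> {1..<Suc k} then conv_hull2 (dimX pr t) (over s t)
          (\<lambda>x. val s t + ereal (Lip pr (Suc t) * nrm pr t (vdiff x (point s t)))) else over s t) \<rparr>"
      unfolding Suc.IH backward_step_def using False by (intro state.equality) (auto simp: fun_eq_iff)
    finally show ?thesis .
  qed
qed simp

text \<open>
  For the last claim, the new upper approximation lies below the cone over the oracle's value
  and the new lower one above the cut, and the two differ by at most \<open>d\<close> at the trial point. Moving to \<open>w\<close>
  costs the Lipschitz constant twice.
\<close>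

lemma iteration:
  assumes s: "invariant s"
  defines "s' \<equiv> cddp_iteration pr O1 Orc s"
  shows "invariant s'" "evals s' = evals s + horizon pr"
    "\<And>t w. t \<in> {1..<horizon pr} \<Longrightarrow> w \<in> Rn (dimX pr t) \<Longrightarrow> gap s' t w \<le> gap s t w"
    "\<exists>x. x 1 = point s 1 \<and> (\<forall>t\<in>{1..horizon pr}. x t \<in> Xset pr t) \<and>
      (\<forall>t\<in>{1..<horizon pr}. \<forall>d::real. gap s (Suc t) (x (Suc t)) \<le> ereal d \<longrightarrow>
        (\<forall>w\<in>Rn (dimX pr t). gap s' t w \<le> ereal (d + 2 * Lip pr (Suc t) * nrm pr t (vdiff w (x t)))))"
proof -
  define f where "f = fold (forward_step Orc) [2..<Suc (horizon pr)] s"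
  define b where "b = fold (backward_step pr) (rev [2..<Suc (horizon pr)]) f"
  have f: "under f = under s" "over f = over s" "evals f = evals s + (horizon pr - 1)" "point f 1 = point s 1"
    "\<And>t. t \<in> {1..horizon pr} \<Longrightarrow> point f t \<in> Xset pr t"
    "\<And>t. t \<in> {1..<horizon pr} \<Longrightarrow> oracle_answer s f t"
    using forward_pass[OF s, of "horizon pr"] horizon_ge_2 unfolding f_def by auto
  have s': "s' = initial_step pr O1 b" by (simp add: s'_def cddp_iteration_def b_def f_def)
  have sand: "sandwich t (under s t) (over s t)" if "t \<in> {1..horizon pr}" for t
    using s that unfolding invariant_def sandwiched_def by blast
  have b: "under b t = (\<lambda>w. max (under s t w) (ereal (cut f t w)))"
    "over b t = conv_hull2 (dimX pr t) (over s t)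
      (\<lambda>w. val f t + ereal (Lip pr (Suc t) * nrm pr t (vdiff w (point f t))))" if "t \<in> {1..<horizon pr}" for t
    unfolding b_def backward_pass using that f(1,2) by auto
  \<comment> \<open>the last stage receives no update\<close>
  have b_top: "under b (horizon pr) = under s (horizon pr)" "over b (horizon pr) = over s (horizon pr)"
    "evals b = evals f"
    unfolding b_def backward_pass using f(1,2) by auto
  have "sandwich t (under b t) (over b t)" if "t \<in> {1..horizon pr}" for t
  proof (cases "t = horizon pr")
    case True then show ?thesis using sand[OF that] b_top by simp
  next
    case False
    then have t: "t \<in> {1..<horizon pr}" using that by auto
    show ?thesis
      unfolding b[OF t] using f(6)[OF t] f(5)[OF that] unfolding oracle_answer_def
      by (intro sandwich_update[OF t sand[OF that]]) auto
  qed
  then have "sandwiched b" using s b_top unfolding invariant_def sandwiched_def by simp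
  from initial_step[OF this] have init: "invariant s'" "under s' = under b" "over s' = over b" "evals s' = Suc (evals b)"
    unfolding s' by auto
  show "invariant s'" by fact
  show "evals s' = evals s + horizon pr" using init(4) b_top(3) f(3) horizon_ge_2 by simp
  have fin: "0 \<le> under s t w" "under s t w < \<infinity>" if "t \<in> {1..<horizon pr}" "w \<in> Rn (dimX pr t)" for t w
    using sand[of t] that unfolding sandwich_def by auto
  show "gap s' t w \<le> gap s t w" if t: "t \<in> {1..<horizon pr}" and w: "w \<in> Rn (dimX pr t)" for t w
    unfolding gap_def init(2,3)
  proof (rule ereal_minus_mono)
    show "over b t w \<le> over s t w" unfolding b[OF t] using conv_hull2_le[OF w] by (rule order_trans) simp
    show "under s t w \<le> under b t w" unfolding b[OF t] by simp
  qed
  have "gap s' t w \<le> ereal (d + 2 * Lip pr (Suc t) * nrm pr t (vdiff w (point f t)))"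
    if t: "t \<in> {1..<horizon pr}" and w: "w \<in> Rn (dimX pr t)"
      and d: "gap s (Suc t) (point f (Suc t)) \<le> ereal d" for t w d
  proof -
    let ?x = "point f t" and ?r = "Lip pr (Suc t) * nrm pr t (vdiff w (point f t))"
    have x: "?x \<in> Rn (dimX pr t)" using f(5)[of t] Xset(1)[of t] t by auto
    note ans = f(6)[OF t, unfolded oracle_answer_def]
    have "val f t - ereal (cut f t ?x) \<le> ereal d" using ans d by (blast intro: order_trans)
    moreover have "val f t \<noteq> -\<infinity>" using ans by blast
    ultimately obtain v where v: "val f t = ereal v" "v - cut f t ?x \<le> d" by (cases "val f t") auto
    have "\<bar>cut f t w - cut f t ?x\<bar> \<le> ?r" using ans w x unfolding lipschitz_fun_def by blast
    then have lip: "cut f t ?x - ?r \<le> cut f t w" by linarith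
    have "over b t w \<le> ereal (v + ?r)"
      unfolding b[OF t] using conv_hull2_le[OF w] by (rule order_trans) (simp add: v)
    moreover have "ereal (cut f t ?x - ?r) \<le> under b t w"
      unfolding b[OF t] using lip by (simp add: le_max_iff_disj)
    ultimately have "gap s' t w \<le> ereal (v + ?r) - ereal (cut f t ?x - ?r)"
      unfolding gap_def init(2,3) by (rule ereal_minus_mono)
    also have "\<dots> \<le> ereal (d + 2 * Lip pr (Suc t) * nrm pr t (vdiff w ?x))" using v(2) by simp
    finally show ?thesis .
  qed
  then show "\<exists>x. x 1 = point s 1 \<and> (\<forall>t\<in>{1..horizon pr}. x t \<in> Xset pr t) \<and>
      (\<forall>t\<in>{1..<horizon pr}. \<forall>d::real. gap s (Suc t) (x (Suc t)) \<le> ereal d \<longrightarrow>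
        (\<forall>w\<in>Rn (dimX pr t). gap s' t w \<le> ereal (d + 2 * Lip pr (Suc t) * nrm pr t (vdiff w (x t)))))"
    using f(4,5) by (intro exI[of _ "point f"]) auto
qed

end

section \<open>Counting iterations\<close>

context cddp_run
begin

definition iterate :: "nat \<Rightarrow> state"
  where "iterate k = (cddp_iteration pr O1 Orc ^^ k) (cddp_init pr O1)"

lemma invariant_iterate: "invariant (iterate k)"
  by (induction k) (simp_all add: iterate_def invariant_init iteration(1))

lemma evals_iterate: "evals (iterate k) = 1 + k * horizon pr"
proof (induction k)
  case 0 then show ?case by (simp add: iterate_def cddp_init_def Let_def split: prod.split)
next
  case (Suc k)
  have "iterate (Suc k) = cddp_iteration pr O1 Orc (iterate k)" by (simp add: iterate_def)
  then show ?case using iteration(2)[OF invariant_iterate] Suc by simp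
qed

lemma gap_iterate_antimono:
  assumes "t \<in> {1..<horizon pr}" "w \<in> Rn (dimX pr t)" "j \<le> k"
  shows "gap (iterate k) t w \<le> gap (iterate j) t w"
  using assms(3)
proof (induction k rule: dec_induct)
  case (step k)
  have "gap (iterate (Suc k)) t w \<le> gap (iterate k) t w"
    using iteration(3)[OF invariant_iterate assms(1,2)] by (simp add: iterate_def)
  then show ?case using step by simp
qed simp

text \<open>
  The existential content of \<open>iteration\<close> for round \<open>k\<close>, given a name so that trial points can be
  chosen for all rounds at once.
\<close>

definition trial_points :: "nat \<Rightarrow> (nat \<Rightarrow> vec) \<Rightarrow> bool"
  where "trial_points k x \<longleftrightarrow> x 1 = point (iterate k) 1 \<and> (\<forall>t\<in>{1..horizon pr}. x t \<in> Xset pr t) \<and>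
    (\<forall>t\<in>{1..<horizon pr}. \<forall>d::real. gap (iterate k) (Suc t) (x (Suc t)) \<le> ereal d \<longrightarrow>
      (\<forall>w\<in>Rn (dimX pr t). gap (iterate (Suc k)) t w \<le> ereal (d + 2 * Lip pr (Suc t) * nrm pr t (vdiff w (x t)))))"

lemma trial_points_exist: "\<exists>x. trial_points k x"
  using iteration(4)[OF invariant_iterate, of k] unfolding trial_points_def by (simp add: iterate_def)

text \<open>
  The gap exceeds its threshold at the first stage but not at the last, so somewhere this changes from one
  stage to the next.
\<close>

lemma saturated_stage_exists:
  fixes \<delta> :: "nat \<Rightarrow> real"
  assumes "ereal (\<delta> 1) < UB (iterate k) - LB (iterate k)" "\<delta> (horizon pr) = 0" "trial_points k x"
  shows "\<exists>t\<in>{1..<horizon pr}. ereal (\<delta> t) < gap (iterate k) t (x t) \<and>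
    gap (iterate k) (Suc t) (x (Suc t)) \<le> ereal (\<delta> (Suc t))"
proof -
  define P where "P t \<longleftrightarrow> ereal (\<delta> t) < gap (iterate k) t (x t)" for t
  have "P 1"
    using less_le_trans[OF assms(1) invariant_gap[OF invariant_iterate]] assms(3)
    unfolding P_def trial_points_def by simp
  moreover have "\<not> P (horizon pr)"
    using invariant_iterate[of k] assms(2) unfolding P_def gap_def invariant_def sandwiched_def by simp
  ultimately have "\<exists>t\<ge>1. t < horizon pr \<and> P t \<and> \<not> P (Suc t)"
    using horizon_ge_2 inc_induct[of 1 "horizon pr" P] by (metis One_nat_def Suc_1 Suc_leD dec_induct)
  then show ?thesis unfolding P_def by (auto simp: not_less)
qed

text \<open>
  Every round is charged to a saturated stage \<open>\<tau> k\<close>. Rounds charged to the same stage have separated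
  trial points, because the gap left behind by the earlier round must still exceed \<open>\<delta> t\<close> at the
  trial point of the later one.
\<close>

lemma iteration_bound:
  fixes \<delta> D :: "nat \<Rightarrow> real"
  assumes running: "\<And>k. k < K \<Longrightarrow> ereal (\<delta> 1) < UB (iterate k) - LB (iterate k)"
    and top: "\<delta> (horizon pr) = 0"
    and decreasing: "\<And>t. t \<in> {1..<horizon pr} \<Longrightarrow> \<delta> (Suc t) < \<delta> t"
    and D: "\<And>t. t \<in> {1..<horizon pr} \<Longrightarrow> 0 < D t"
    and diam: "\<And>t. t \<in> {1..<horizon pr} \<Longrightarrow>
      \<exists>c\<in>Rn (dimX pr t). \<forall>x\<in>Xset pr t. nrm pr t (vdiff x c) \<le> D t / 2"
  shows "real K \<le> (\<Sum>t\<in>{1..<horizon pr}. (1 + 2 * Lip pr (Suc t) * D t / (\<delta> t - \<delta> (Suc t))) ^ dimX pr t)"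
proof -
  obtain x where x: "\<And>k. trial_points k (x k)" using trial_points_exist by metis
  have "\<forall>k\<in>{..<K}. \<exists>t\<in>{1..<horizon pr}. ereal (\<delta> t) < gap (iterate k) t (x k t) \<and>
    gap (iterate k) (Suc t) (x k (Suc t)) \<le> ereal (\<delta> (Suc t))"
    using saturated_stage_exists[OF running top x] by simp
  then obtain \<tau> where \<tau>: "\<And>k. k < K \<Longrightarrow> \<tau> k \<in> {1..<horizon pr}"
    "\<And>k. k < K \<Longrightarrow> ereal (\<delta> (\<tau> k)) < gap (iterate k) (\<tau> k) (x k (\<tau> k))"
    "\<And>k. k < K \<Longrightarrow> gap (iterate k) (Suc (\<tau> k)) (x k (Suc (\<tau> k))) \<le> ereal (\<delta> (Suc (\<tau> k)))"
    by (metis lessThan_iff)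
  have stage: "real (card {k \<in> {..<K}. \<tau> k = t}) \<le> (1 + 2 * Lip pr (Suc t) * D t / (\<delta> t - \<delta> (Suc t))) ^ dimX pr t"
    if t: "t \<in> {1..<horizon pr}" for t
  proof -
    interpret Rn_norm "dimX pr t" "nrm pr t" using t by (intro Rn_norm_stage) auto
    have t1: "t \<in> {1..horizon pr}" using t by auto
    let ?A = "{k \<in> {..<K}. \<tau> k = t}"
    define \<sigma> where "\<sigma> = (\<delta> t - \<delta> (Suc t)) / (2 * Lip pr (Suc t))"
    have L: "0 < Lip pr (Suc t)" using Prob(4)[of "Suc t"] t by auto
    have \<sigma>: "0 < \<sigma>" using L decreasing[OF t] by (simp add: \<sigma>_def)
    have X: "x k t \<in> Xset pr t" "x k t \<in> Rn (dimX pr t)" for k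
      using x[of k] t1 Xset(1)[OF t1] unfolding trial_points_def by auto
    have apart: "\<sigma> < nrm pr t (vdiff (x k t) (x j t))" if "j \<in> ?A" "k \<in> ?A" "j < k" for j k
    proof -
      have "ereal (\<delta> t) < gap (iterate k) t (x k t)" using \<tau>(2)[of k] that by auto
      also have "\<dots> \<le> gap (iterate (Suc j)) t (x k t)"
        using that by (intro gap_iterate_antimono t X) simp
      also have "\<dots> \<le> ereal (\<delta> (Suc t) + 2 * Lip pr (Suc t) * nrm pr t (vdiff (x k t) (x j t)))"
        using x[of j] \<tau>(3)[of j] that t X(2) unfolding trial_points_def by auto
      finally show ?thesis using L by (simp add: \<sigma>_def field_simps)
    qed
    have far: "\<sigma> < nrm pr t (vdiff (x k t) (x j t))" if "j \<in> ?A" "k \<in> ?A" "j \<noteq> k" for j k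
      using apart[of j k] apart[of k j] that vdiff_commute[OF X(2) X(2), of k j] by (cases j k rule: linorder_cases) auto
    have inj: "inj_on (\<lambda>k. x k t) ?A"
    proof (rule inj_onI, rule ccontr)
      fix j k assume "j \<in> ?A" "k \<in> ?A" "x j t = x k t" "j \<noteq> k"
      with far[of j k] \<sigma> vdiff_self show False by simp
    qed
    obtain c where c: "c \<in> Rn (dimX pr t)" "\<forall>x\<in>Xset pr t. nrm pr t (vdiff x c) \<le> D t / 2"
      using diam[OF t] by blast
    have "real (card ((\<lambda>k. x k t) ` ?A)) \<le> (1 + D t / \<sigma>) ^ dimX pr t"
    proof (rule packing_bound[OF _ _ c(1) \<sigma>])
      show "0 \<le> D t" using D[OF t] by simp
      fix p q assume "p \<in> (\<lambda>k. x k t) ` ?A" "q \<in> (\<lambda>k. x k t) ` ?A" "p \<noteq> q"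
      then obtain j k where "p = x k t" "q = x j t" "j \<in> ?A" "k \<in> ?A" "j \<noteq> k" by blast
      then show "\<sigma> \<le> nrm pr t (vdiff p q)" using far[of j k] by simp
    qed (use X c(2) in auto)
    also have "D t / \<sigma> = 2 * Lip pr (Suc t) * D t / (\<delta> t - \<delta> (Suc t))" by (simp add: \<sigma>_def)
    finally show ?thesis using inj by (simp add: card_image)
  qed
  have "K = (\<Sum>k<K. 1)" by simp
  also have "\<dots> = (\<Sum>t\<in>{1..<horizon pr}. \<Sum>k\<in>{k \<in> {..<K}. \<tau> k = t}. 1)"
    using \<tau>(1) by (intro sum.group[symmetric]) auto
  also have "\<dots> = (\<Sum>t\<in>{1..<horizon pr}. card {k \<in> {..<K}. \<tau> k = t})" by simp
  finally have "real K = (\<Sum>t\<in>{1..<horizon pr}. real (card {k \<in> {..<K}. \<tau> k = t}))"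
    by (metis of_nat_sum)
  also have "\<dots> \<le> (\<Sum>t\<in>{1..<horizon pr}. (1 + 2 * Lip pr (Suc t) * D t / (\<delta> t - \<delta> (Suc t))) ^ dimX pr t)"
    by (intro sum_mono stage)
  finally show ?thesis .
qed

end

theorem theorem1:
  fixes pr :: problem and O1 :: initial_oracle and Orc :: stage_oracle
    and D :: "nat \<Rightarrow> real" and \<epsilon> :: real
  assumes "well_posed pr"
    and "is_initial_oracle pr O1"
    and "\<And>t. t \<in> {2..horizon pr} \<Longrightarrow> is_stage_oracle pr Orc t"
    and "\<epsilon> > 0"
    and "\<And>t. t \<in> {1..horizon pr - 1} \<Longrightarrow> D t > 0"
    and "\<And>t. t \<in> {1..horizon pr - 1} \<Longrightarrow>
      \<exists>c\<in>Rn (dimX pr t). \<forall>x\<in>Xset pr t. nrm pr t (vdiff x c) \<le> D t / 2"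
  shows "\<exists>s. cddp pr O1 Orc \<epsilon> = Some s \<and>
    real (evals s) \<le> 1 + real (horizon pr) *
      Inf {(\<Sum>t = 1..horizon pr - 1.
              (1 + 2 * Lip pr (t + 1) * D t / (\<delta> t - \<delta> (t + 1))) ^ dimX pr t) |
           \<delta> :: nat \<Rightarrow> real.
             \<delta> 1 = \<epsilon> \<and> \<delta> (horizon pr) = 0 \<and>
             (\<forall>t\<in>{1..horizon pr - 1}. \<delta> t > \<delta> (t + 1))}"
proof -
  interpret cddp_run pr O1 Orc
    using assms(1-3) by unfold_locales
  let ?T = "horizon pr"
  define b where "b s \<longleftrightarrow> ereal \<epsilon> < UB s - LB s" for s :: state
  define S where "S \<delta> = (\<Sum>t = 1..?T - 1. (1 + 2 * Lip pr (t + 1) * D t / (\<delta> t - \<delta> (t + 1))) ^ dimX pr t)"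
    for \<delta> :: "nat \<Rightarrow> real"
  define \<Delta> where "\<Delta> = {\<delta> :: nat \<Rightarrow> real. \<delta> 1 = \<epsilon> \<and> \<delta> ?T = 0 \<and> (\<forall>t\<in>{1..?T - 1}. \<delta> t > \<delta> (t + 1))}"
  have stages: "{1..?T - 1} = {1..<?T}" using horizon_ge_2 by auto
  have bound: "real K \<le> S \<delta>" if "\<And>k. k < K \<Longrightarrow> b (iterate k)" "\<delta> \<in> \<Delta>" for K \<delta>
    unfolding S_def stages Suc_eq_plus1[symmetric]
    by (rule iteration_bound) (use that assms(5,6) in \<open>auto simp: b_def \<Delta>_def stages\<close>)
  \<comment> \<open>equally spaced thresholds show that the infimum is over a nonempty set; with them the
    loop cannot run forever\<close>
  define \<delta>0 where "\<delta>0 t = \<epsilon> * (real ?T - real t) / (real ?T - 1)" for t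
  have "\<delta>0 (t + 1) < \<delta>0 t" for t
    using horizon_ge_2 \<open>\<epsilon> > 0\<close> unfolding \<delta>0_def by (intro divide_strict_right_mono mult_strict_left_mono) auto
  moreover have "\<delta>0 1 = \<epsilon>" using horizon_ge_2 by (simp add: \<delta>0_def)
  ultimately have \<delta>0: "\<delta>0 \<in> \<Delta>" by (simp add: \<Delta>_def \<delta>0_def)
  have ex: "\<exists>k. \<not> b (iterate k)"
  proof (rule ccontr)
    assume "\<nexists>k. \<not> b (iterate k)"
    then have "real (nat \<lceil>S \<delta>0\<rceil> + 1) \<le> S \<delta>0" using bound[OF _ \<delta>0] by blast
    then show False by linarith
  qed
  define K where "K = (LEAST k. \<not> b (iterate k))"
  have "b (iterate k)" if "k < K" for k using not_less_Least[of k] that unfolding K_def by blast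
  then have "real K \<le> S \<delta>" if "\<delta> \<in> \<Delta>" for \<delta> using bound that by blast
  then have "real K \<le> Inf (S ` \<Delta>)" using \<delta>0 by (intro cINF_greatest) auto
  then have "real (evals (iterate K)) \<le> 1 + real ?T * Inf (S ` \<Delta>)"
    by (simp add: evals_iterate mult.commute[of "real K"] mult_left_mono)
  moreover have "cddp pr O1 Orc \<epsilon> = Some (iterate K)"
    using ex unfolding cddp_def while_option_def K_def iterate_def b_def by simp
  moreover have "{S \<delta> | \<delta>. \<delta> 1 = \<epsilon> \<and> \<delta> ?T = 0 \<and> (\<forall>t\<in>{1..?T - 1}. \<delta> t > \<delta> (t + 1))} = S ` \<Delta>"
    unfolding \<Delta>_def by blast
  ultimately show ?thesis unfolding S_def by auto
qed

end
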